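(* Let $p$ be a sufficiently large prime and let $F(X)\in\mathbb{F}_p[X]$ be a square-free polynomial of degree $d_F\geq 1$. Then for every integer $m$ with $2\leq m\ll(\log p)^{1/4}$ we have $$\sum_{a=0}^{m-1}\left(\Phi_p(F;m,a)-\frac{1}{m}\right)^2\ll_{d_F}\frac{m^2}{\log p},$$ where the implied constant depends only on $d_F$ (and on the implied constant in the bound on $m$).
   Context: $\chi_p=\left(\frac{\cdot}{p}\right)$ denotes the Legendre symbol modulo $p$ (with $\chi_p(0)=0$). For a positive integer $k\leq p$, $S_p(F,k)=\sum_{n\leq k}\chi_p(F(n))$, the sum over positive integers $n\leq k$ (with $F(n)$ evaluated in $\mathbb{F}_p$). For an integer $m\ge 2$ and residue $a$, $\Phi_p(F;m,a)=\frac{1}{p}\left|\{1\leq k\leq p: S_p(F,k)\equiv a \bmod m\}\right|$. *)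

theory Defs
  imports
    "HOL-Analysis.Analysis"
    "HOL-Number_Theory.Number_Theory"
    "Berlekamp_Zassenhaus.Poly_Mod"
begin

text \<open>
  The prime \<open>p\<close> has to be quantified inside a formula, after constants that must not depend on it.
  A polynomial over \<open>\<F>\<^sub>p\<close> is therefore given by an arbitrary integer polynomial \<open>F\<close>, read
  modulo \<open>p\<close>; its degree and square-freeness over \<open>\<F>\<^sub>p\<close> are \<open>poly_mod.degree_m (int p) F\<close> and
  \<open>poly_mod.square_free_m (int p) F\<close>. The sum below depends only on \<open>F\<close> modulo \<open>p\<close>, because
  the Legendre symbol does.
\<close>

definition legendre_sum :: "nat \<Rightarrow> int poly \<Rightarrow> nat \<Rightarrow> int" where
  "legendre_sum p F k = (\<Sum>n = 1..k. Legendre (poly F (int n)) (int p))"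

definition residue_proportion :: "nat \<Rightarrow> int poly \<Rightarrow> nat \<Rightarrow> int \<Rightarrow> real" where
  "residue_proportion p F m a =
     real (card {k \<in> {1..p}. [legendre_sum p F k = a] (mod (int m))}) / real p"

end

theory Submission
  imports Defs "Berlekamp_Zassenhaus.Finite_Field"
begin

text \<open>
  By Parseval the sum equals \<open>1 / (m p\<^sup>2)\<close> times the sum over \<open>0 < b < m\<close> of \<open>\<bar>Z\<^sub>b\<bar>\<^sup>2\<close>, where
  \<open>Z\<^sub>b\<close> is the sum of \<open>exp (2 \<pi> i b S\<^sub>p(F,k) / m)\<close> over \<open>k \<le> p\<close>. Averaging \<open>Z\<^sub>b\<close> over shifts of \<open>k\<close> by
  less than \<open>H \<approx> log p / 8\<close> and applying Cauchy--Schwarz reduces to the correlations of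
  \<open>exp (2 \<pi> i b S\<^sub>p(F,k) / m)\<close> at distance less than \<open>H\<close>. These behave as for independent signs, i.e.
  like powers of \<open>cos (2 \<pi> b / m)\<close>, since the Weil bound applies to the products of the
  \<open>\<chi>\<^sub>p(F(k + j))\<close>: for \<open>H d < p\<close> no nonempty product of the shifts \<open>F(X + j)\<close>, \<open>j < H\<close>, is a constant times a
  square. If \<open>2 b = m\<close> the cosine is \<open>-1\<close>, but then the summands of \<open>Z\<^sub>b\<close> alternate in sign up to the roots of \<open>F\<close>.
  The Weil bound is proved by Stepanov's method.
\<close>

hide_const (open) Module.smult Coset.order UnivPoly.coeff UnivPoly.monom

subsection \<open>Stepanov's auxiliary polynomial\<close>

text \<open>The shape \<open>m^2 / log p\<close> is that of
  \<open>1 / (H (1 - |cos \<theta>|))\<close>: for \<theta> = \<open>2 \<pi> b / m\<close> the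
  geometric decay of the correlations saves a factor \<open>H (1 - |cos \<theta>|)\<close>, and
  \<open>1 - |cos \<theta>|\<close> is at least \<open>1 / (2 m^2)\<close> unless
  \<open>2 b = m\<close>. The length \<open>H\<close> cannot exceed a small multiple of
  \<open>log p\<close>, because multiplying out \<open>H\<close> factors
  \<open>cos \<theta> + i x sin \<theta>\<close> creates \<open>2 ^ H\<close> character sums, each
  of size up to a multiple of \<open>H d sqrt p\<close>. With \<open>H\<close> near
  \<open>log p / 8\<close> one has \<open>2 ^ H <= 2 p^(1/8)\<close>, and a power of
  \<open>p\<close> is left to absorb all logarithms. The polynomials in these sums have degree up to
  \<open>H d\<close>, which grows with \<open>p\<close>, so the Weil bound has to be explicit in the
  degree. Stepanov's argument stays within the prime field: polynomials must be non-squares only up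
  to constants of that field, and the auxiliary polynomial is found by counting.\<close>

lemma power_dvd_if_higher_pderiv_vanish:
  fixes R :: "'a::field poly"
  assumes "l \<le> CHAR('a)" "\<And>i. i < l \<Longrightarrow> poly ((pderiv ^^ i) R) x = 0"
  shows "[:-x, 1:] ^ l dvd R"
  using assms
proof (induction l arbitrary: R)
  case 0
  then show ?case by simp
next
  case (Suc l)
  show ?case
  proof (cases "R = 0")
    case False
    have dvd': "[:-x, 1:] ^ l dvd pderiv R"
    proof (rule Suc.IH)
      fix i assume "i < l"
      then show "poly ((pderiv ^^ i) (pderiv R)) x = 0"
        using Suc.prems(2)[of "Suc i"] by (simp add: funpow_swap1)
    qed (use Suc.prems in simp)
    show ?thesis
    proof (rule ccontr)
      assume nd: "\<not> ?thesis"
      let ?L = "[:-x, 1:]"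
      \<comment> \<open>If the order \<open>m\<close> of \<open>R\<close> at \<open>x\<close> were
        at most \<open>l\<close>, it would be nonzero in the field, so differentiation would lower
        the order to exactly \<open>m - 1\<close>. But \<open>pderiv R\<close> is divisible by
        \<open>?L ^ m\<close>.\<close>
      define m where "m = order x R"
      have "m < Suc l"
        using nd False unfolding m_def by (meson not_le order_divides)
      have "poly R x = 0" using Suc.prems(2)[of 0] by simp
      then have "m \<noteq> 0" using False by (simp add: m_def order_root)
      then obtain m' where m': "m = Suc m'" by (cases m) auto
      obtain Q where Q: "R = ?L ^ m * Q" "\<not> ?L dvd Q"
        using order_decomp[OF False, of x] m_def by auto
      have "?L ^ m dvd pderiv R"
        using dvd' \<open>m < Suc l\<close> by (meson dvd_trans le_imp_power_dvd less_Suc_eq_le)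
      moreover have "pderiv R = ?L ^ m * pderiv Q + ?L ^ m' * smult (of_nat m) Q"
        unfolding Q(1) m'
        by (simp add: pderiv_mult pderiv_power_Suc pderiv_pCons mult.commute del: power_Suc)
      ultimately have "?L ^ m dvd ?L ^ m' * smult (of_nat m) Q"
        by (metis dvd_add_right_iff dvd_triv_left)
      then have "?L ^ m' * ?L dvd ?L ^ m' * smult (of_nat m) Q"
        by (simp add: m' mult.commute)
      then have "?L dvd smult (of_nat m) Q"
        by (subst (asm) dvd_mult_cancel_left) simp
      moreover have "of_nat m \<noteq> (0 :: 'a)"
        using \<open>m \<noteq> 0\<close> \<open>m < Suc l\<close> Suc.prems(1)
        by (metis less_le_trans nat_dvd_not_less of_nat_eq_0_iff_char_dvd neq0_conv)
      ultimately show False using Q(2) by (simp add: dvd_smult_iff)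
    qed
  qed simp
qed

lemma sum_order_le_degree:
  fixes R :: "'a::idom poly"
  assumes "R \<noteq> 0" "finite Z" "\<And>x. x \<in> Z \<Longrightarrow> [:-x, 1:] ^ l dvd R"
  shows "l * card Z \<le> degree R"
proof -
  have "l * card Z = (\<Sum>x\<in>Z. l)" by simp
  also have "\<dots> \<le> (\<Sum>x\<in>Z. count (proots R) x)"
    using assms(1,3) by (intro sum_mono) (metis count_proots order_divides)
  also have "\<dots> \<le> size (proots R)"
  proof -
    have "(\<Sum>x\<in>Z. count (proots R) x) = (\<Sum>x\<in>Z \<inter> set_mset (proots R). count (proots R) x)"
      using assms(2) by (intro sum.mono_neutral_right) (auto simp: not_in_iff)
    also have "\<dots> \<le> size (proots R)"
      unfolding size_multiset_overloaded_eq by (intro sum_mono2) auto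
    finally show ?thesis .
  qed
  also have "\<dots> \<le> degree R" by (rule size_proots_le)
  finally show ?thesis .
qed

text \<open>Counts both the unknowns and the possible values of the conditions in the pigeonhole
  argument. The zero polynomial has degree 0, so for \<open>B = 0\<close> the set would be empty
  instead of a singleton.\<close>

lemma card_poly_degree_less:
  assumes "B > 0"
  shows "finite {q :: 'a::{finite,zero} poly. degree q < B}"
    and "card {q :: 'a poly. degree q < B} = CARD('a) ^ B"
proof -
  let ?P = "{q :: 'a poly. degree q < B}"
  have "bij_betw (\<lambda>q. restrict (coeff q) {..<B}) ?P ({..<B} \<rightarrow>\<^sub>E (UNIV :: 'a set))"
  proof (rule bij_betw_imageI)
    show "inj_on (\<lambda>q. restrict (coeff q) {..<B}) ?P"
    proof (rule inj_onI)
      fix q r :: "'a poly"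
      assume *: "q \<in> ?P" "r \<in> ?P" "restrict (coeff q) {..<B} = restrict (coeff r) {..<B}"
      show "q = r"
      proof (rule poly_eqI)
        fix i show "coeff q i = coeff r i"
          using * by (cases "i < B") (auto dest: fun_cong[of _ _ i] simp: coeff_eq_0)
      qed
    qed
    show "(\<lambda>q. restrict (coeff q) {..<B}) ` ?P = {..<B} \<rightarrow>\<^sub>E UNIV"
    proof (intro equalityI subsetI)
      fix w :: "nat \<Rightarrow> 'a" assume w: "w \<in> {..<B} \<rightarrow>\<^sub>E UNIV"
      let ?c = "\<lambda>i. if i < B then w i else 0"
      have "coeff (Abs_poly ?c) = ?c"
        by (rule coeff_Abs_poly[of "B - 1"]) (use assms in auto)
      moreover from this have "degree (Abs_poly ?c) \<le> B - 1"
        by (intro degree_le) (use assms in auto)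
      ultimately show "w \<in> (\<lambda>q. restrict (coeff q) {..<B}) ` ?P"
        using w assms by (intro image_eqI[of _ _ "Abs_poly ?c"]) (auto simp: restrict_def PiE_def extensional_def)
    qed (auto split: if_splits)
  qed
  then show "finite ?P" "card ?P = CARD('a) ^ B"
    by (auto simp: bij_betw_same_card card_PiE bij_betw_finite finite_PiE)
qed

text \<open>The cofactor of \<open>f ^ (e - k)\<close> in the \<open>k\<close>-th derivative of
  \<open>f ^ e * u\<close>. It is additive in \<open>u\<close>, and its degree grows by at most
  \<open>degree f\<close> per derivative, which keeps the number of vanishing conditions
  small.\<close>

fun stepanov_coeff :: "'a::field poly \<Rightarrow> nat \<Rightarrow> nat \<Rightarrow> 'a poly \<Rightarrow> 'a poly" where
  "stepanov_coeff f e 0 u = u"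
| "stepanov_coeff f e (Suc k) u =
     smult (of_nat (e - k)) (pderiv f * stepanov_coeff f e k u) + f * pderiv (stepanov_coeff f e k u)"

lemma higher_pderiv_power_mult:
  "k \<le> e \<Longrightarrow> (pderiv ^^ k) (f ^ e * u) = f ^ (e - k) * stepanov_coeff f e k u"
proof (induction k)
  case (Suc k)
  obtain e' where e': "e - k = Suc e'" using Suc.prems by (cases "e - k") auto
  then have "e - Suc k = e'" by simp
  with Suc e' show ?case
    by (simp add: pderiv_mult pderiv_power_Suc algebra_simps del: of_nat_Suc power_Suc)
      (simp add: algebra_simps)
qed simp

lemma stepanov_coeff_diff:
  "stepanov_coeff f e k (u - v) = stepanov_coeff f e k u - stepanov_coeff f e k v"
  by (induction k) (simp_all add: pderiv_diff right_diff_distrib smult_diff_right)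

lemma degree_stepanov_coeff:
  fixes u :: "'a::field poly"
  shows "degree (stepanov_coeff f e k u) \<le> degree u + k * degree f"
proof (induction k)
  case (Suc k)
  let ?w = "stepanov_coeff f e k u"
  have degree_pderiv_le': "degree (pderiv g) \<le> degree g" for g :: "'a poly"
    using degree_pderiv_le[of g] by linarith
  have "degree (smult (of_nat (e - k)) (pderiv f * ?w)) \<le> degree f + degree ?w"
    by (meson add_right_mono degree_mult_le degree_pderiv_le' degree_smult_le order_trans)
  moreover have "degree (f * pderiv ?w) \<le> degree f + degree ?w"
    by (meson add_left_mono degree_mult_le degree_pderiv_le' order_trans)
  ultimately show ?case using Suc by (auto intro!: degree_add_le)
qed simp

text \<open>In characteristic \<open>p\<close> the power \<open>X ^ (j p)\<close> has derivative
  zero and so behaves like a constant.\<close>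

lemma higher_pderiv_mult_monom:
  fixes u :: "'a::field poly"
  shows "(pderiv ^^ k) (u * monom 1 (j * CHAR('a))) = (pderiv ^^ k) u * monom 1 (j * CHAR('a))"
  by (induction k) (simp_all add: pderiv_mult pderiv_monom)

text \<open>The factor \<open>f ^ l\<close> keeps powers of \<open>f\<close> in all derivatives of
  order at most \<open>l\<close>, \<open>f ^ c\<close> takes the value \<open>a\<close> at the
  points to be counted, and \<open>X ^ (j p)\<close> has high degree but the value
  \<open>x ^ j\<close> on the prime field. Thus a polynomial of high degree is governed by
  conditions of low degree.\<close>

definition stepanov_poly ::
  "'a::field poly \<Rightarrow> nat \<Rightarrow> nat \<Rightarrow> nat \<Rightarrow> (nat \<Rightarrow> 'a poly) \<Rightarrow> (nat \<Rightarrow> 'a poly) \<Rightarrow> 'a poly" where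
  "stepanov_poly f c l J r s =
     (\<Sum>j<J. (f ^ l * r j + f ^ (l + c) * s j) * monom 1 (j * CHAR('a)))"

text \<open>The remaining factor of the \<open>k\<close>-th derivative at points with
  \<open>x ^ p = x\<close> and \<open>f(x) ^ c = a\<close>, once \<open>f(x) ^ (l - k)\<close> is
  split off. Requiring it to vanish as a polynomial gives linear conditions on the coefficients of
  \<open>r\<close> and \<open>s\<close>, whatever the set of points is.\<close>

definition stepanov_cond ::
  "'a::field poly \<Rightarrow> nat \<Rightarrow> nat \<Rightarrow> nat \<Rightarrow> 'a \<Rightarrow> (nat \<Rightarrow> 'a poly) \<Rightarrow> (nat \<Rightarrow> 'a poly) \<Rightarrow> nat \<Rightarrow> 'a poly" where
  "stepanov_cond f c l J a r s k =
     (\<Sum>j<J. (stepanov_coeff f l k (r j) + smult a (stepanov_coeff f (l + c) k (s j))) * monom 1 j)"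

lemma poly_higher_pderiv_stepanov_poly:
  fixes f :: "'a::field poly"
  assumes "k \<le> l" "x ^ CHAR('a) = x" "poly f x ^ c = a"
  shows "poly ((pderiv ^^ k) (stepanov_poly f c l J r s)) x
    = poly f x ^ (l - k) * poly (stepanov_cond f c l J a r s k) x"
proof -
  have "l + c - k = (l - k) + c" using assms(1) by simp
  then have e: "(pderiv ^^ k) (f ^ (l + c) * u) = f ^ (l - k) * f ^ c * stepanov_coeff f (l + c) k u" for u
    using higher_pderiv_power_mult[of k "l + c" f u] assms(1) by (simp only: power_add trans_le_add1)
  have x: "x ^ (j * CHAR('a)) = x ^ j" for j
    using assms(2) by (metis mult.commute power_mult)
  have "poly ((pderiv ^^ k) (stepanov_poly f c l J r s)) x
     = (\<Sum>j<J. (poly f x ^ (l - k) * poly (stepanov_coeff f l k (r j)) x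
           + poly f x ^ (l - k) * a * poly (stepanov_coeff f (l + c) k (s j)) x) * x ^ j)"
    unfolding stepanov_poly_def higher_pderiv_sum higher_pderiv_mult_monom higher_pderiv_add e
      higher_pderiv_power_mult[OF assms(1)]
    by (simp add: poly_sum poly_monom x assms(3))
  also have "\<dots> = poly f x ^ (l - k) * poly (stepanov_cond f c l J a r s k) x"
    unfolding stepanov_cond_def poly_sum sum_distrib_left
    by (intro sum.cong refl) (simp add: poly_monom algebra_simps)
  finally show ?thesis .
qed

lemma stepanov_cond_diff:
  "stepanov_cond f c l J a (\<lambda>j. r j - r' j) (\<lambda>j. s j - s' j) k
    = stepanov_cond f c l J a r s k - stepanov_cond f c l J a r' s' k"
  unfolding stepanov_cond_def sum_subtractf[symmetric]
  by (intro sum.cong refl) (simp add: stepanov_coeff_diff smult_diff_right algebra_simps)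

lemma degree_stepanov_cond:
  assumes "\<And>j. j < J \<Longrightarrow> degree (r j) < B" "\<And>j. j < J \<Longrightarrow> degree (s j) < B" "J > 0"
  shows "degree (stepanov_cond f c l J a r s k) < B + k * degree f + J"
proof -
  have "degree (stepanov_cond f c l J a r s k) \<le> (B - 1) + k * degree f + (J - 1)"
    unfolding stepanov_cond_def
  proof (rule degree_sum_le)
    fix j assume "j \<in> {..<J}"
    then have j: "j < J" by simp
    have "degree (stepanov_coeff f l k (r j)) \<le> (B - 1) + k * degree f"
      using degree_stepanov_coeff[of f l k "r j"] assms(1)[OF j] by linarith
    moreover have "degree (smult a (stepanov_coeff f (l + c) k (s j))) \<le> (B - 1) + k * degree f"
      using degree_stepanov_coeff[of f "l + c" k "s j"] assms(2)[OF j]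
        degree_smult_le[of a "stepanov_coeff f (l + c) k (s j)"] by linarith
    ultimately have "degree (stepanov_coeff f l k (r j) + smult a (stepanov_coeff f (l + c) k (s j)))
        \<le> (B - 1) + k * degree f"
      by (rule degree_add_le)
    moreover have "degree (monom (1::'a) j) \<le> J - 1"
      using j degree_monom_le[of "1::'a" j] by linarith
    ultimately show "degree ((stepanov_coeff f l k (r j) + smult a (stepanov_coeff f (l + c) k (s j)))
        * monom 1 j) \<le> (B - 1) + k * degree f + (J - 1)"
      by (meson add_mono degree_mult_le order_trans)
  qed simp
  moreover have "B > 0" using assms(1)[of 0] assms(3) by simp
  ultimately show ?thesis using assms(3) by linarith
qed

text \<open>Pigeonhole in place of linear algebra: \<open>2 * B * J\<close> free coefficients are
  mapped additively to at most \<open>l * (B + J) + degree f * l^2\<close> coefficients, so two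
  choices have the same image, and their difference is a nontrivial solution.\<close>

lemma stepanov_exists:
  fixes f :: "'a::{field,finite} poly"
  assumes "B > 0" "J > 0" "l * (B + J) + degree f * l\<^sup>2 < 2 * B * J"
  shows "\<exists>r s. (\<forall>j. degree (r j) < B \<and> degree (s j) < B) \<and> (\<exists>j<J. r j \<noteq> 0 \<or> s j \<noteq> 0)
    \<and> (\<forall>k<l. stepanov_cond f c l J a r s k = 0)"
proof -
  let ?P = "\<lambda>b. {q :: 'a poly. degree q < b}"
  let ?n = "degree f"
  define V where "V = ({..<J} \<rightarrow>\<^sub>E ?P B) \<times> ({..<J} \<rightarrow>\<^sub>E ?P B)"
  define W where "W = (\<Pi>\<^sub>E k\<in>{..<l}. ?P (B + k * ?n + J))"
  define \<Phi> where "\<Phi> = (\<lambda>(r, s). \<lambda>k\<in>{..<l}. stepanov_cond f c l J a r s k)"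
  have "card V = CARD('a) ^ (2 * B * J)"
    by (simp add: V_def card_cartesian_product card_PiE card_poly_degree_less[OF assms(1)]
        power_mult[symmetric] power_add[symmetric] mult_2 distrib_right)
  moreover have "card W = CARD('a) ^ (\<Sum>k<l. B + k * ?n + J)"
    using assms by (simp add: W_def card_PiE card_poly_degree_less power_sum)
  moreover have "(\<Sum>k<l. B + k * ?n + J) \<le> (\<Sum>k<l. B + l * ?n + J)"
    by (intro sum_mono) auto
  moreover have "(\<Sum>k<l. B + l * ?n + J) = l * (B + J) + ?n * l\<^sup>2"
    by (simp add: algebra_simps power2_eq_square)
  moreover have "card {0, 1 :: 'a} \<le> CARD('a)"
    by (intro card_mono) auto
  ultimately have "card W < card V"
    using assms(3) by (simp add: power_strict_increasing_iff)
  moreover have "\<Phi> ` V \<subseteq> W"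
  proof (intro image_subsetI)
    fix v assume "v \<in> V"
    then obtain r s where v: "v = (r, s)" "\<And>j. j < J \<Longrightarrow> degree (r j) < B" "\<And>j. j < J \<Longrightarrow> degree (s j) < B"
      by (auto simp: V_def PiE_def Pi_def)
    have "degree (stepanov_cond f c l J a r s k) < B + k * ?n + J" for k
      using v(2,3) assms(2) by (rule degree_stepanov_cond)
    then show "\<Phi> v \<in> W"
      unfolding v(1) \<Phi>_def W_def prod.case restrict_PiE_iff by blast
  qed
  moreover have "finite W"
    unfolding W_def using assms(1) by (intro finite_PiE card_poly_degree_less(1)) auto
  ultimately have "card (\<Phi> ` V) < card V"
    using card_mono[of W "\<Phi> ` V"] by linarith
  then have "\<not> inj_on \<Phi> V" by (rule pigeonhole)
  then obtain v v' where v: "v \<in> V" "v' \<in> V" "v \<noteq> v'" "\<Phi> v = \<Phi> v'"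
    by (auto simp: inj_on_def)
  obtain r s r' s' where rs: "v = (r, s)" "v' = (r', s')" by (cases v, cases v')
  let ?r = "\<lambda>j. if j < J then r j - r' j else 0" and ?s = "\<lambda>j. if j < J then s j - s' j else 0"
  show ?thesis
  proof (rule exI[of _ ?r], rule exI[of _ ?s], intro conjI allI impI)
    show "degree (?r j) < B" "degree (?s j) < B" for j
      using v(1,2) assms(1) by (auto simp: rs V_def PiE_def Pi_def intro!: degree_diff_less)
    have "\<exists>j<J. r j \<noteq> r' j \<or> s j \<noteq> s' j"
    proof (rule ccontr)
      assume "\<not> ?thesis"
      then have "r = r'" "s = s'" using v(1,2)
        by (auto simp: rs V_def intro!: PiE_ext[of _ "{..<J}" "\<lambda>_. ?P B"])
      with v(3) show False by (simp add: rs)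
    qed
    then show "\<exists>j<J. ?r j \<noteq> 0 \<or> ?s j \<noteq> 0" by auto
    fix k assume k: "k < l"
    have "stepanov_cond f c l J a ?r ?s k = stepanov_cond f c l J a (\<lambda>j. r j - r' j) (\<lambda>j. s j - s' j) k"
      by (simp add: stepanov_cond_def)
    also have "\<dots> = 0"
      using fun_cong[OF v(4), of k] k by (simp add: stepanov_cond_diff rs \<Phi>_def)
    finally show "stepanov_cond f c l J a ?r ?s k = 0" .
  qed
qed

subsection \<open>The Weil bound for quadratic character sums\<close>

text \<open>Says, with denominators cleared, that \<open>f\<close> is not a nonzero constant times a
  square in the field of rational functions. Constants of the base field suffice, since the one that
  has to be excluded is \<open>f(0) ^ p\<close>.\<close>

definition nonsquare_poly :: "'a::field poly \<Rightarrow> bool" where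
  "nonsquare_poly f \<longleftrightarrow> (\<forall>a r s. a \<noteq> 0 \<longrightarrow> f * r\<^sup>2 = smult a (s\<^sup>2) \<longrightarrow> r = 0)"

text \<open>Modulo \<open>X ^ p\<close> the relation reads \<open>r 0 = - f ^ c * s 0\<close>.
  Squaring and multiplying by \<open>f\<close> gives \<open>f * (r 0)^2 = f ^ p * (s 0)^2\<close>,
  where \<open>f ^ p\<close> is congruent to the constant \<open>f(0) ^ p\<close> by Frobenius. Both
  sides then have degree below \<open>p\<close>, so this is an identity, and non-squareness forces
  \<open>r 0 = s 0 = 0\<close>. Dividing by \<open>X ^ p\<close> leaves a relation with one term
  less.\<close>

lemma stepanov_poly_nonzero:
  fixes f :: "'a::field poly"
  assumes "prime CHAR('a)" "CHAR('a) = 2 * c + 1" "poly f 0 \<noteq> 0"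
    and nonsq: "nonsquare_poly f"
    and "degree f + 2 * (B - 1) < CHAR('a)"
  shows "(\<Sum>j<J. (r j + f ^ c * s j) * monom 1 (j * CHAR('a))) = 0 \<Longrightarrow>
    \<forall>j<J. degree (r j) < B \<and> degree (s j) < B \<Longrightarrow> \<forall>j<J. r j = 0 \<and> s j = 0"
proof (induction J arbitrary: r s)
  case (Suc J)
  let ?p = "CHAR('a)"
  let ?X = "monom 1 ?p :: 'a poly"
  define Y where "Y = (\<Sum>j<J. (r (Suc j) + f ^ c * s (Suc j)) * monom 1 (j * ?p))"
  have "(\<Sum>j<J. (r (Suc j) + f ^ c * s (Suc j)) * monom 1 (Suc j * ?p)) = ?X * Y"
    unfolding Y_def sum_distrib_left
    by (intro sum.cong refl) (simp add: mult_monom mult.left_commute)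
  then have eq: "r 0 + f ^ c * s 0 + ?X * Y = 0"
    using Suc.prems(1) by (simp add: sum.lessThan_Suc_shift monom_0 one_pCons[symmetric] del: sum.lessThan_Suc)
  obtain a h where f: "f = pCons a h" by (cases f)
  have "a \<noteq> 0" using assms(3) f by simp
  have "f = [:a:] + monom 1 1 * h" by (simp add: f monom_altdef)
  then have "f ^ ?p = [:a:] ^ ?p + (monom 1 1 * h) ^ ?p"
    by (metis assms(1) freshmans_dream semiring_char_poly)
  then have fp: "f ^ ?p = [:a ^ ?p:] + ?X * h ^ ?p"
    by (simp add: power_mult_distrib monom_power poly_const_pow)
  have s0: "f ^ c * s 0 = - r 0 - ?X * Y"
    using eq by (subst eq_iff_diff_eq_0) (simp add: algebra_simps)
  have "f * (f ^ c * s 0)\<^sup>2 = f ^ ?p * (s 0)\<^sup>2"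
    by (simp add: assms(2) power_mult_distrib power_mult[symmetric] mult_ac)
  then have "f * (r 0)\<^sup>2 - smult (a ^ ?p) ((s 0)\<^sup>2) = ?X * (h ^ ?p * (s 0)\<^sup>2 - f * Y * (2 * r 0 + ?X * Y))"
    unfolding s0 fp by (simp add: algebra_simps power2_eq_square)
  then have "?X dvd f * (r 0)\<^sup>2 - smult (a ^ ?p) ((s 0)\<^sup>2)" by simp
  moreover have "degree (f * (r 0)\<^sup>2 - smult (a ^ ?p) ((s 0)\<^sup>2)) < ?p"
  proof -
    have rs: "degree (r 0) \<le> B - 1" "degree (s 0) \<le> B - 1" using Suc.prems(2) by auto
    have "degree (f * (r 0)\<^sup>2) \<le> degree f + 2 * (B - 1)"
      using degree_mult_le[of f "(r 0)\<^sup>2"] degree_power_le[of "r 0" 2] rs(1) by linarith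
    moreover have "degree (smult (a ^ ?p) ((s 0)\<^sup>2)) \<le> 2 * (B - 1)"
      using degree_smult_le[of "a ^ ?p" "(s 0)\<^sup>2"] degree_power_le[of "s 0" 2] rs(2) by linarith
    ultimately show ?thesis
      using assms(5) degree_diff_le_max[of "f * (r 0)\<^sup>2" "smult (a ^ ?p) ((s 0)\<^sup>2)"] by linarith
  qed
  ultimately have sq: "f * (r 0)\<^sup>2 = smult (a ^ ?p) ((s 0)\<^sup>2)"
    using dvd_imp_degree_le[of ?X] by (fastforce simp: degree_monom_eq)
  then have "r 0 = 0" using nonsq \<open>a \<noteq> 0\<close> unfolding nonsquare_poly_def by (metis power_not_zero)
  with sq \<open>a \<noteq> 0\<close> have "s 0 = 0" by simp
  have "Y = 0" using eq \<open>r 0 = 0\<close> \<open>s 0 = 0\<close> by (simp add: monom_eq_0_iff)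
  then have "\<forall>j<J. r (Suc j) = 0 \<and> s (Suc j) = 0"
    using Suc.prems(2) by (intro Suc.IH) (auto simp: Y_def)
  with \<open>r 0 = 0\<close> \<open>s 0 = 0\<close> show ?case by (metis less_Suc_eq_0_disj)
qed simp

text \<open>Each counted point is a zero of \<open>R\<close> of order at least \<open>l\<close>, so
  \<open>l\<close> times their number is at most the degree of \<open>R\<close>; \<open>R\<close>
  itself is nonzero by the previous lemma.\<close>

lemma stepanov_bound:
  fixes f :: "'a::finite_field poly"
  assumes p: "CARD('a) = CHAR('a)" "CHAR('a) = 2 * c + 1" and f0: "poly f 0 \<noteq> 0"
    and nonsq: "nonsquare_poly f"
    and B: "B > 0" "degree f + 2 * (B - 1) < CHAR('a)"
    and J: "J > 0" "l \<le> CHAR('a)" "l * (B + J) + degree f * l\<^sup>2 < 2 * B * J"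
  shows "l * card {x. poly f x ^ c = a} \<le> l * degree f + (B - 1) + degree f * c + (J - 1) * CHAR('a)"
proof -
  let ?p = "CHAR('a)"
  have "prime ?p" by (rule prime_CHAR_semidom) (use CHAR_pos in blast)
  obtain r s where rs: "\<And>j. degree (r j) < B" "\<And>j. degree (s j) < B"
    "\<exists>j<J. r j \<noteq> 0 \<or> s j \<noteq> 0" "\<And>k. k < l \<Longrightarrow> stepanov_cond f c l J a r s k = 0"
    using stepanov_exists[OF B(1) J(1,3), where c=c and a=a] by metis
  define R where "R = stepanov_poly f c l J r s"
  have "f \<noteq> 0" using f0 by auto
  have R_eq: "R = f ^ l * (\<Sum>j<J. (r j + f ^ c * s j) * monom 1 (j * ?p))"
    unfolding R_def stepanov_poly_def sum_distrib_left
    by (intro sum.cong refl) (simp add: power_add algebra_simps)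
  have "R \<noteq> 0"
  proof
    assume "R = 0"
    then have "(\<Sum>j<J. (r j + f ^ c * s j) * monom 1 (j * ?p)) = 0"
      using R_eq \<open>f \<noteq> 0\<close> by simp
    then have "\<forall>j<J. r j = 0 \<and> s j = 0"
      using rs(1,2) by (intro stepanov_poly_nonzero[OF \<open>prime ?p\<close> p(2) f0 nonsq B(2)]) auto
    then show False using rs(3) by auto
  qed
  moreover have "[:-x, 1:] ^ l dvd R" if "poly f x ^ c = a" for x
  proof (rule power_dvd_if_higher_pderiv_vanish)
    fix i assume "i < l"
    moreover have "x ^ ?p = x"
      using finite_field_power_card_eq_same[of x] by (simp add: p(1))
    ultimately show "poly ((pderiv ^^ i) R) x = 0"
      unfolding R_def using poly_higher_pderiv_stepanov_poly[of i l x f c a J r s] that rs(4) by simp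
  qed fact
  ultimately have "l * card {x. poly f x ^ c = a} \<le> degree R"
    by (intro sum_order_le_degree) auto
  also have "degree R \<le> l * degree f + (B - 1) + degree f * c + (J - 1) * ?p"
  proof -
    let ?S = "\<Sum>j<J. (r j + f ^ c * s j) * monom 1 (j * ?p)"
    have "degree (f ^ l) \<le> l * degree f" using degree_power_le[of f l] by (simp add: mult.commute)
    moreover have "degree ?S \<le> B - 1 + (degree f * c + (J - 1) * ?p)"
    proof (rule degree_sum_le)
      fix j assume "j \<in> {..<J}"
      then have "j * ?p \<le> (J - 1) * ?p" by (intro mult_right_mono) auto
      then have *: "degree (monom (1::'a) (j * ?p)) \<le> (J - 1) * ?p"
        using degree_monom_le order.trans by blast
      have "degree (r j) \<le> (B - 1) + degree f * c" using rs(1)[of j] by linarith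
      moreover have "degree (f ^ c * s j) \<le> (B - 1) + degree f * c"
        using degree_mult_le[of "f ^ c" "s j"] degree_power_le[of f c] rs(2)[of j] by linarith
      ultimately have "degree (r j + f ^ c * s j) \<le> (B - 1) + degree f * c"
        by (intro degree_add_le)
      then show "degree ((r j + f ^ c * s j) * monom 1 (j * ?p)) \<le> B - 1 + (degree f * c + (J - 1) * ?p)"
        using degree_mult_le[of "r j + f ^ c * s j" "monom 1 (j * ?p)"] * by linarith
    qed simp
    ultimately show ?thesis
      unfolding R_eq using degree_mult_le[of "f ^ l" ?S] by linarith
  qed
  finally show ?thesis .
qed

lemma card_power_eq_le:
  fixes f :: "'a::finite_field poly"
  assumes p: "CARD('a) = CHAR('a)" "CHAR('a) = 2 * c + 1" and f0: "poly f 0 \<noteq> 0"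
    and nonsq: "nonsquare_poly f"
    and n: "degree f = n" "n > 0" "2 * (n + 1) \<le> CHAR('a)" and "64 \<le> CHAR('a)"
  shows "real (card {x. poly f x ^ c = a}) \<le> CHAR('a) / 2 + 13 * n * sqrt CHAR('a)"
proof -
  define q where "q = CHAR('a)"
  note [simp] = q_def[symmetric]
  define sq where "sq = sqrt (real q)"
  have sq: "sq ^ 2 = q" "sq \<ge> 8"
    using assms(8) real_le_rsqrt[of 8 q] by (auto simp: sq_def)
  \<comment> \<open>\<open>B\<close> is about as large as non-vanishing of \<open>R\<close> permits.
    The choice \<open>J = l / 2\<close> would just balance \<open>l * B\<close> against
    \<open>2 * B * J\<close>; the surplus \<open>e\<close> pays for the other terms
    \<open>l * J + n * l^2\<close>, which are of order \<open>n * q\<close> because \<open>l\<close>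
    is close to \<open>sqrt q\<close>. The main term \<open>(J - 1) * q / l\<close> of the final
    bound is then about \<open>q / 2\<close>.\<close>
  define l where "l = nat \<lfloor>sq\<rfloor>"
  have l: "real l \<le> sq" "sq < real l + 1" using sq(2) by (auto simp: l_def)
  define B where "B = (q - n) div 2"
  define e where "e = 3 * n + 3"
  define J where "J = l div 2 + e"
  have rB: "real B \<ge> real q / 4" "real B \<le> real q / 2" using n(3) by (auto simp: B_def)
  have B0: "B > 0" using n(3) assms(8) by (auto simp: B_def)
  have "8 * sq \<le> sq * sq" using sq(2) by (intro mult_right_mono) auto
  then have sq8: "8 * sq \<le> q" using sq(1) by (simp add: power2_eq_square)
  have l2: "real (l\<^sup>2) \<le> q"
    using l(1) power_mono[OF l(1), of 2] sq(1) by simp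
  have rJ: "real J \<le> l / 2 + e" "2 * real J \<ge> real l - 1 + 2 * e"
    by (auto simp: J_def)
  have "l * real J \<le> l * (l / 2 + e)" using rJ(1) by (intro mult_left_mono) auto
  also have "\<dots> = real (l\<^sup>2) / 2 + l * real e" by (simp add: power2_eq_square algebra_simps)
  also have "\<dots> \<le> q / 2 + (q / 8) * real e"
    using l2 l(1) sq8 by (intro add_mono mult_right_mono) auto
  finally have 1: "l * real J \<le> q / 2 + (q / 8) * real e" .
  have 2: "real n * real (l\<^sup>2) \<le> n * real q" using l2 by (intro mult_left_mono) auto
  have "(q / 4) * (2 * real e - 1) \<le> B * (2 * real J - l)"
    using rB(1) rJ(2) by (intro mult_mono) (auto simp: e_def)
  moreover have "q / 2 + (q / 8) * real e + n * real q < (q / 4) * (2 * real e - 1)"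
  proof -
    have "q * (9 * real n / 8 + 3/8 - n) > 0" using assms(8) n(2) by (intro mult_pos_pos) auto
    then show ?thesis by (simp add: e_def algebra_simps)
  qed
  ultimately have "l * (real B + J) + n * real (l\<^sup>2) < 2 * real B * J"
    using 1 2 by (simp add: algebra_simps)
  then have "real (l * (B + J) + n * l\<^sup>2) < real (2 * B * J)" by simp
  then have main: "l * (B + J) + degree f * l\<^sup>2 < 2 * B * J"
    unfolding n(1) of_nat_less_iff .
  have "l \<le> q" using l(1) sq8 sq(2) by linarith
  have "degree f + 2 * (B - 1) < q" unfolding n(1) B_def using n(3) by simp
  then have "l * card {x. poly f x ^ c = a} \<le> l * n + (B - 1) + n * c + (J - 1) * q"
    using stepanov_bound[OF p f0 nonsq B0 _ _ _ main, of a] \<open>l \<le> q\<close> n(1) by (simp add: J_def e_def)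
  then have "real (l * card {x. poly f x ^ c = a}) \<le> real (l * n + (B - 1) + n * c + (J - 1) * q)"
    unfolding of_nat_le_iff .
  also have "\<dots> \<le> l * real n + q / 2 + n * (q / 2) + (l / 2 + e - 1) * q"
  proof -
    have "real (B - 1) \<le> real B" by simp
    then have "real (B - 1) \<le> q / 2" using rB(2) by (rule order.trans)
    moreover have "n * real c \<le> n * (q / 2)" using p(2) by (intro mult_left_mono) auto
    moreover have "real (J - 1) * q \<le> (l / 2 + e - 1) * q"
      using rJ(1) by (intro mult_right_mono) (auto simp: J_def e_def of_nat_diff)
    ultimately show ?thesis by simp
  qed
  also have "\<dots> = l * (n + q / 2) + q * (7 * n / 2 + 5 / 2)"
    by (simp add: e_def algebra_simps add_divide_distrib)
  also have "\<dots> \<le> l * (n + q / 2) + l * (2 * sq) * (7 * n / 2 + 5 / 2)"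
  proof -
    have "sq \<le> 2 * l" using l(2) sq(2) by linarith
    then have "sq * sq \<le> 2 * l * sq" using sq(2) by (intro mult_right_mono) auto
    then have "q \<le> l * (2 * sq)" using sq(1) by (simp add: power2_eq_square algebra_simps)
    then show ?thesis by (intro add_left_mono mult_right_mono) auto
  qed
  also have "\<dots> = l * (q / 2 + (n + sq * (7 * n + 5)))" by (simp add: algebra_simps)
  \<comment> \<open>The constant is \<open>13 = 1 + 7 + 5\<close>, as \<open>n\<close> and
    \<open>sq\<close> are both at most \<open>n * sq\<close>.\<close>
  also have "\<dots> \<le> l * (q / 2 + 13 * n * sq)"
  proof -
    have "real n * 1 \<le> n * sq" "1 * sq \<le> n * sq"
      using sq(2) n(2) by (auto intro!: mult_left_mono mult_right_mono)
    then show ?thesis by (intro mult_left_mono) (auto simp: algebra_simps)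
  qed
  finally have "real l * real (card {x. poly f x ^ c = a}) \<le> real l * (q / 2 + 13 * n * sq)"
    by simp
  moreover have "real l > 0" using l(2) sq(2) by linarith
  ultimately show ?thesis by (simp add: sq_def)
qed

text \<open>For \<open>c = (p - 1) / 2\<close> this is the quadratic character of
  \<open>f(x)\<close>, by Euler's criterion, with values in the integers so that they can be summed
  there.\<close>

definition poly_char :: "nat \<Rightarrow> 'a::field poly \<Rightarrow> 'a \<Rightarrow> int" where
  "poly_char c f x = (if poly f x ^ c = 1 then 1 else if poly f x ^ c = -1 then -1 else 0)"

text \<open>Stepanov's method bounds the number of points with value 1 or -1 only from above. Since
  these points and at most \<open>n\<close> roots exhaust the field, lower bounds follow; hence the
  constant \<open>27 = 2 * 13 + 1\<close>.\<close>

lemma weil_bound: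
  fixes f :: "'a::finite_field poly"
  assumes p: "CARD('a) = CHAR('a)" "CHAR('a) = 2 * c + 1" "c > 0"
    and nonsq: "nonsquare_poly f"
    and n: "degree f > 0"
  shows "\<bar>real_of_int (\<Sum>x\<in>UNIV. poly_char c f x)\<bar> \<le> 27 * degree f * sqrt CHAR('a)"
proof -
  define q where "q = CHAR('a)"
  define n where "n = degree f"
  define sq where "sq = sqrt (real q)"
  have "n > 0" using n by (simp add: n_def)
  have q: "q \<ge> 3" using p(2,3) by (simp add: q_def)
  have sq: "sq * sq = q" "sq \<ge> 1" using q by (auto simp: sq_def)
  have "f \<noteq> 0" using n by auto
  have le_q: "\<bar>real_of_int (\<Sum>x\<in>UNIV. poly_char c f x)\<bar> \<le> q"
  proof -
    have "\<bar>\<Sum>x\<in>UNIV. poly_char c f x\<bar> \<le> (\<Sum>x\<in>(UNIV::'a set). 1)"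
      by (rule order.trans[OF sum_abs]) (intro sum_mono, auto simp: poly_char_def)
    then have "\<bar>\<Sum>x\<in>UNIV. poly_char c f x\<bar> \<le> int q" using p(1) by (simp add: q_def)
    then show ?thesis by linarith
  qed
  \<comment> \<open>In the first two cases \<open>q\<close> is at most a small multiple of
    \<open>n * sq\<close>, and the trivial bound \<open>q\<close> is enough.\<close>
  consider "q < 64" | "q < 2 * (n + 1)" | "64 \<le> q" "2 * (n + 1) \<le> q" by linarith
  then show ?thesis
  proof cases
    case 1
    have "sq < 8" using 1 real_sqrt_less_mono[of q 64] by (simp add: sq_def)
    then have "real q \<le> 8 * sq" using mult_right_mono[of sq 8 sq] sq by simp
    also have "\<dots> \<le> 27 * n * sq" using \<open>n > 0\<close> sq(2) by (intro mult_right_mono) auto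
    finally show ?thesis using le_q by (simp add: sq_def n_def q_def)
  next
    case 2
    then have "real q \<le> 4 * real n * 1" using \<open>n > 0\<close> by simp
    also have "\<dots> \<le> 27 * real n * sq" using sq(2) by (intro mult_mono) auto
    finally show ?thesis using le_q by (simp add: sq_def n_def q_def)
  next
    case 3
    have card_roots: "card {x. poly f x = 0} \<le> n"
      using card_poly_roots_bound[of f] \<open>f \<noteq> 0\<close> by (simp add: n_def)
    have "\<exists>t. poly f t \<noteq> 0"
    proof (rule ccontr)
      assume "\<not> ?thesis"
      then have "{x. poly f x = 0} = UNIV" by auto
      then show False using card_roots 3(2) p(1) by (simp add: q_def)
    qed
    then obtain t where t: "poly f t \<noteq> 0" by blast
    \<comment> \<open>Stepanov's argument needs a nonzero constant term, so a point where
      \<open>f\<close> does not vanish is moved to the origin.\<close>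
    define g where "g = pcompose f [:t, 1:]"
    have "degree g = n" by (simp add: g_def n_def degree_pcompose)
    have g_nonsq: "nonsquare_poly g"
      unfolding nonsquare_poly_def
    proof (intro allI impI)
      fix a r s assume that: "a \<noteq> 0" "g * r\<^sup>2 = smult a (s\<^sup>2)"
      have "pcompose [:t, 1:] [:-t, 1:] = [:0, 1:]" by (simp add: pcompose_pCons)
      then have "pcompose g [:-t, 1:] = f"
        by (simp only: g_def pcompose_assoc[symmetric] pcompose_idR)
      then have "f * (pcompose r [:-t, 1:])\<^sup>2 = smult a ((pcompose s [:-t, 1:])\<^sup>2)"
        using arg_cong[OF that(2), of "\<lambda>u. pcompose u [:-t, 1:]"]
        by (simp add: power2_eq_square pcompose_mult pcompose_smult)
      then have "pcompose r [:-t, 1:] = 0"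
        using nonsq that(1) unfolding nonsquare_poly_def by blast
      then show "r = 0" by (simp add: pcompose_eq_0_iff)
    qed
    have bnd: "real (card {x. poly f x ^ c = a}) \<le> q / 2 + 13 * n * sq" for a
    proof -
      have "bij_betw (\<lambda>x. t + x) {x. poly g x ^ c = a} {x. poly f x ^ c = a}"
        by (rule bij_betwI[of _ _ _ "\<lambda>x. x - t"]) (auto simp: g_def poly_pcompose algebra_simps)
      then have "card {x. poly g x ^ c = a} = card {x. poly f x ^ c = a}"
        by (rule bij_betw_same_card)
      moreover have "poly g 0 \<noteq> 0" using t by (simp add: g_def poly_pcompose)
      ultimately show ?thesis
        using card_power_eq_le[OF p(1,2) _ g_nonsq \<open>degree g = n\<close> \<open>n > 0\<close>, of a] 3
        by (simp add: q_def sq_def)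
    qed
    have ne: "(1::'a) \<noteq> -1"
    proof
      assume "(1::'a) = -1"
      then have "of_nat 2 = (0::'a)" by (metis add_eq_0_iff2 of_nat_numeral one_add_one)
      then have "q dvd 2" unfolding q_def by (simp only: of_nat_eq_0_iff_char_dvd)
      then show False using 3(1) by (auto dest: dvd_imp_le)
    qed
    let ?A = "{x. poly f x ^ c = 1}" and ?B = "{x. poly f x ^ c = -1}"
    have "(\<Sum>x\<in>UNIV. poly_char c f x) = (\<Sum>x\<in>UNIV. (if x \<in> ?A then 1 else 0) - (if x \<in> ?B then 1 else 0))"
      using ne by (intro sum.cong) (auto simp: poly_char_def)
    also have "\<dots> = int (card ?A) - int (card ?B)"
      by (simp add: sum_subtractf sum.If_cases)
    finally have sum_eq: "(\<Sum>x\<in>UNIV. poly_char c f x) = int (card ?A) - int (card ?B)" .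
    have "UNIV = ?A \<union> ?B \<union> {x. poly f x = 0}"
    proof -
      have "poly f x ^ c = 1 \<or> poly f x ^ c = -1" if "poly f x \<noteq> 0" for x
      proof -
        have "poly f x * (poly f x ^ c)\<^sup>2 = poly f x * 1"
          using finite_field_power_card_eq_same[of "poly f x"] p(1,2)
          by (simp add: power_mult[symmetric] mult.commute)
        then have "(poly f x ^ c)\<^sup>2 = 1" using that by simp
        then show ?thesis by (simp add: power2_eq_1_iff)
      qed
      then show ?thesis by auto
    qed
    then have "q = card (?A \<union> ?B \<union> {x. poly f x = 0})" using p(1) q_def by simp
    also have "\<dots> \<le> card ?A + card ?B + card {x. poly f x = 0}"
      using card_Un_le[of ?A ?B] card_Un_le[of "?A \<union> ?B" "{x. poly f x = 0}"] by linarith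
    finally have lower: "real q \<le> real (card ?A) + card ?B + n" using card_roots by linarith
    have "real n * 1 \<le> n * sq" using sq(2) by (intro mult_left_mono) auto
    then have "\<bar>real (card ?A) - card ?B\<bar> \<le> 27 * n * sq"
      using bnd[of 1] bnd[of "-1"] lower by (simp add: abs_le_iff algebra_simps)
    then show ?thesis unfolding sum_eq by (simp add: n_def q_def sq_def)
  qed
qed

subsection \<open>Products of shifts of a square-free polynomial\<close>

definition shift_poly :: "'a::comm_ring_1 \<Rightarrow> 'a poly \<Rightarrow> 'a poly" where
  "shift_poly t f = pcompose f [:t, 1:]"

lemma shift_poly_shift [simp]: "shift_poly t (shift_poly u f) = shift_poly (t + u) f"
  by (simp add: shift_poly_def pcompose_assoc[symmetric] pcompose_pCons add.commute)

lemma shift_poly_0 [simp]: "shift_poly 0 f = f"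
  unfolding shift_poly_def by (rule pcompose_idR)

lemma shift_poly_1: "shift_poly t 1 = 1"
  by (simp add: shift_poly_def pcompose_1)

lemma shift_poly_mult: "shift_poly t (f * g) = shift_poly t f * shift_poly t g"
  by (simp add: shift_poly_def pcompose_mult)

lemma poly_shift_poly: "poly (shift_poly t f) x = poly f (t + x)"
  by (simp add: shift_poly_def poly_pcompose)

lemma degree_shift_poly [simp]: "degree (shift_poly t f) = degree (f :: 'a::idom poly)"
  by (simp add: shift_poly_def degree_pcompose)

lemma lead_coeff_shift_poly: "lead_coeff (shift_poly t f) = lead_coeff (f :: 'a::idom poly)"
  unfolding shift_poly_def by (subst lead_coeff_comp) simp_all

lemma shift_poly_eq_0_iff [simp]: "shift_poly t f = 0 \<longleftrightarrow> f = (0 :: 'a::idom poly)"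
  by (simp add: shift_poly_def pcompose_eq_0_iff)

lemma shift_poly_dvd_iff: "shift_poly t f dvd shift_poly t g \<longleftrightarrow> f dvd g"
proof
  have mono: "f dvd g \<Longrightarrow> shift_poly t f dvd shift_poly t g" for f g :: "'a poly" and t
    by (auto simp: shift_poly_mult elim!: dvdE)
  then show "f dvd g \<Longrightarrow> shift_poly t f dvd shift_poly t g" .
  show "f dvd g" if "shift_poly t f dvd shift_poly t g"
    using mono[OF that, of "-t"] by simp
qed

lemma prime_elem_shift_poly:
  fixes f :: "'a::field poly"
  assumes "prime_elem f"
  shows "prime_elem (shift_poly t f)"
proof (rule prime_elemI)
  show "shift_poly t f \<noteq> 0" using assms unfolding prime_elem_def by simp
  show "\<not> shift_poly t f dvd 1"
    using assms shift_poly_dvd_iff[of t f 1] unfolding prime_elem_def by (metis shift_poly_1)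
  fix a b assume "shift_poly t f dvd a * b"
  then have "shift_poly t f dvd shift_poly t (shift_poly (-t) (a * b))"
    by simp
  then have "f dvd shift_poly (-t) (a * b)"
    by (simp only: shift_poly_dvd_iff)
  then have "f dvd shift_poly (-t) a * shift_poly (-t) b"
    by (simp only: shift_poly_mult)
  then have "f dvd shift_poly (-t) a \<or> f dvd shift_poly (-t) b"
    using assms by (simp add: prime_elem_dvd_mult_iff)
  then have "shift_poly t f dvd shift_poly t (shift_poly (-t) a)
      \<or> shift_poly t f dvd shift_poly t (shift_poly (-t) b)"
    by (simp only: shift_poly_dvd_iff)
  then show "shift_poly t f dvd a \<or> shift_poly t f dvd b"
    by simp
qed

text \<open>The multiples of \<open>u\<close> exhaust the prime field, so \<open>f\<close> is
  constant as a function and, by its degree, as a polynomial. The example \<open>X ^ p - X\<close>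
  shows that the degree bound is sharp.\<close>

lemma shift_poly_eq_self_imp:
  fixes f :: "'a::prime_card mod_ring poly"
  assumes "shift_poly u f = f" "u \<noteq> 0" "degree f < CARD('a)"
  shows "degree f = 0"
proof -
  have step: "poly f (x + u) = poly f x" for x
    using arg_cong[OF assms(1), of "\<lambda>g. poly g x"] by (simp add: poly_shift_poly add.commute)
  have "poly f (of_nat k * u) = poly f 0" for k
    by (induction k) (simp_all add: algebra_simps step[of "of_nat _ * u", simplified algebra_simps])
  moreover have "\<exists>k. x = of_nat k * u" for x
    using surj_of_nat_mod_ring[of "x / u"] assms(2) by (auto simp: divide_eq_eq)
  ultimately have const: "poly f x = poly f 0" for x by metis
  let ?g = "f - [:poly f 0:]"
  have "?g = 0"
  proof (rule ccontr)
    assume "?g \<noteq> 0"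
    then have "card {x. poly ?g x = 0} \<le> degree ?g" by (rule card_poly_roots_bound)
    moreover have "{x. poly ?g x = 0} = UNIV" using const by auto
    moreover have "degree ?g \<le> degree f" by (rule degree_diff_le) auto
    ultimately show False using assms(3) by simp
  qed
  then have "f = [:poly f 0:]" by simp
  then show ?thesis by (metis degree_pCons_0)
qed

lemma prod_dvd_if_pairwise_coprime:
  fixes f :: "'b \<Rightarrow> 'a::semiring_gcd"
  assumes "finite A" "\<And>x. x \<in> A \<Longrightarrow> f x dvd g"
    "\<And>x y. x \<in> A \<Longrightarrow> y \<in> A \<Longrightarrow> x \<noteq> y \<Longrightarrow> Rings.coprime (f x) (f y)"
  shows "prod f A dvd g"
  using assms
proof (induction A rule: finite_induct)
  case (insert x A)
  then have "\<And>y. y \<in> A \<Longrightarrow> Rings.coprime (f x) (f y)" by auto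
  with \<open>finite A\<close> have "Rings.coprime (f x) (prod f A)"
    by (induction A rule: finite_induct) auto
  with insert show ?case by (simp add: divides_mult)
qed simp

text \<open>Shifts of \<open>P\<close> share degree and leading coefficient, so one divides another
  only if they are equal. Distinct shifts are therefore coprime, and the product of those dividing
  \<open>f\<close> divides \<open>f\<close>.\<close>

lemma card_shifts_dvd_le:
  fixes P :: "'a::prime_card mod_ring poly"
  assumes "prime_elem P" "P dvd f" "f \<noteq> 0" "degree f < CARD('a)"
  shows "card {t. shift_poly t P dvd f} \<le> degree f"
proof -
  let ?T = "{t. shift_poly t P dvd f}"
  have "P \<noteq> 0" using assms(1) by auto
  have "degree P \<noteq> 0" using assms(1) by (auto simp: is_unit_iff_degree)
  have "degree P < CARD('a)" using assms(2-4) dvd_imp_degree_le[of P f] by linarith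
  have "prod (\<lambda>t. shift_poly t P) ?T dvd f"
  proof (rule prod_dvd_if_pairwise_coprime)
    fix t u assume tu: "t \<in> ?T" "u \<in> ?T" "t \<noteq> u"
    have "\<not> shift_poly t P dvd shift_poly u P"
    proof
      assume "shift_poly t P dvd shift_poly u P"
      then obtain h where h: "shift_poly u P = shift_poly t P * h" by (elim dvdE)
      have "shift_poly u P \<noteq> 0" using \<open>P \<noteq> 0\<close> by simp
      then have "degree (shift_poly u P) = degree (shift_poly t P) + degree h"
        unfolding h by (intro degree_mult_eq) auto
      then have "degree h = 0" by simp
      then obtain a where a: "h = [:a:]" by (rule degree_eq_zeroE)
      have "lead_coeff P = lead_coeff P * lead_coeff h"
        using arg_cong[OF h, of lead_coeff] by (simp only: lead_coeff_mult lead_coeff_shift_poly)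
      then have "lead_coeff h = 1" using \<open>P \<noteq> 0\<close> by simp
      then have "a = 1" using a by simp
      then have "shift_poly (-t) (shift_poly u P) = shift_poly (-t) (shift_poly t P)"
        using h a by simp
      then have "shift_poly (u - t) P = P"
        by simp
      then show False
        using shift_poly_eq_self_imp[of "u - t" P] tu(3) \<open>degree P \<noteq> 0\<close> \<open>degree P < CARD('a)\<close> by simp
    qed
    then show "Rings.coprime (shift_poly t P) (shift_poly u P)"
      using prime_elem_shift_poly[OF assms(1)] by (intro prime_elem_imp_coprime)
  qed auto
  then have "degree (prod (\<lambda>t. shift_poly t P) ?T) \<le> degree f"
    using assms(3) by (rule dvd_imp_degree_le)
  moreover have "degree (prod (\<lambda>t. shift_poly t P) ?T) = card ?T * degree P"
    using \<open>P \<noteq> 0\<close> by (subst degree_prod_eq_sum_degree) auto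
  moreover have "card ?T * 1 \<le> card ?T * degree P"
    using \<open>degree P \<noteq> 0\<close> by (intro mult_le_mono2) simp
  ultimately show ?thesis by linarith
qed

lemma prime_elem_not_dvd_prod:
  assumes "finite A" "prime_elem Q" "\<And>x. x \<in> A \<Longrightarrow> \<not> Q dvd f x"
  shows "\<not> Q dvd prod f A"
  using assms by (induction A rule: finite_induct) (auto simp: prime_elem_dvd_mult_iff dest: prime_elem_not_unit)

text \<open>Parity: in \<open>Q * A * r^2 = a * s^2\<close> the multiplicity of \<open>Q\<close> is
  odd on the left and even on the right.\<close>

lemma nonsquare_poly_if_simple_prime_factor:
  fixes Q :: "'a::field_gcd poly"
  assumes "prime_elem Q" "\<not> Q dvd A"
  shows "nonsquare_poly (Q * A)"
  unfolding nonsquare_poly_def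
proof (intro allI impI)
  fix a r s assume a: "a \<noteq> 0" and eq: "Q * A * r\<^sup>2 = smult a (s\<^sup>2)"
  show "r = 0"
  proof (rule ccontr)
    assume "r \<noteq> 0"
    have "Q \<noteq> 0" "A \<noteq> 0" using assms by auto
    with eq \<open>r \<noteq> 0\<close> have "s \<noteq> 0" by auto
    have "is_unit [:a:]" using a by (simp add: is_unit_const_poly_iff)
    have "multiplicity Q (Q * A * r\<^sup>2) = multiplicity Q ([:a:] * s\<^sup>2)" using eq by simp
    then have "multiplicity Q Q + multiplicity Q A + 2 * multiplicity Q r
       = multiplicity Q [:a:] + 2 * multiplicity Q s"
      using assms(1) \<open>Q \<noteq> 0\<close> \<open>A \<noteq> 0\<close> \<open>r \<noteq> 0\<close> \<open>s \<noteq> 0\<close> a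
      by (simp add: prime_elem_multiplicity_mult_distrib prime_elem_multiplicity_power_distrib
          del: mult_pCons_left)
    moreover have "multiplicity Q Q = 1" using assms(1) by (intro multiplicity_self) auto
    moreover have "multiplicity Q A = 0" using assms(2) by (rule not_dvd_imp_multiplicity_0)
    moreover have "multiplicity Q [:a:] = 0" using \<open>is_unit [:a:]\<close> by (rule multiplicity_unit_right)
    ultimately show False by presburger
  qed
qed

text \<open>
  The translates \<open>t\<close> for which the shift of a fixed prime factor divides \<open>f\<close> leave a gap of length \<open>H\<close>.
  Relative to the last such \<open>t\<close> before the gap, only the shift by the maximum of \<open>J\<close> contributes, and it
  contributes a simple factor.
\<close>

lemma nonsquare_poly_prod_shifts:
  fixes f :: "'a::prime_card mod_ring poly"
  assumes sqf: "\<And>g. degree g \<noteq> 0 \<Longrightarrow> \<not> g * g dvd f" and deg: "degree f \<noteq> 0"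
    and J: "J \<subseteq> {..<H}" "J \<noteq> {}" and H: "H * degree f < CARD('a)"
  shows "nonsquare_poly (\<Prod>j\<in>J. shift_poly (of_nat j) f)"
proof -
  have "finite J" using J(1) finite_subset by blast
  have "H > 0" using J by auto
  have "f \<noteq> 0" using deg by auto
  have "degree f < CARD('a)" using H \<open>H > 0\<close> by (metis le_less_trans mult_le_mono1 nat_mult_1 Suc_leI One_nat_def)
  obtain P where P: "P dvd f" "prime_elem P"
    using prime_divisor_exists[of f] deg \<open>f \<noteq> 0\<close> by (auto simp: is_unit_iff_degree)
  have "degree P \<noteq> 0" using P(2) by (auto simp: is_unit_iff_degree)
  define T where "T = {t. shift_poly t P dvd f}"
  have "0 \<in> T" using P(1) by (simp add: T_def)
  have cardT: "card T \<le> degree f"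
    unfolding T_def using P \<open>f \<noteq> 0\<close> \<open>degree f < CARD('a)\<close> by (intro card_shifts_dvd_le)
  obtain w where w: "\<And>i. i < H \<Longrightarrow> w + of_nat i \<notin> T"
  proof -
    \<comment> \<open>\<open>?W\<close> consists of the starting points of windows of length
      \<open>H\<close> that meet \<open>T\<close>. There are at most \<open>degree f * H < p\<close>
      of them, so some window avoids \<open>T\<close>.\<close>
    let ?W = "(\<lambda>(t, i). t - of_nat i) ` (T \<times> {..<H})"
    have "card ?W \<le> card (T \<times> {..<H})" by (intro card_image_le) auto
    also have "\<dots> \<le> degree f * H" using cardT by (simp add: card_cartesian_product)
    also have "\<dots> < CARD('a mod_ring)" using H by (simp add: mult.commute)
    finally have "?W \<noteq> UNIV" by auto
    then obtain w where "w \<notin> ?W" by auto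
    then have "w + of_nat i \<notin> T" if "i < H" for i
      using that by (force simp: image_iff)
    then show thesis by (rule that)
  qed
  define i where "i = (LEAST i. w - of_nat i \<in> T)"
  obtain k where "w = of_nat k" using surj_of_nat_mod_ring by blast
  then have "w - of_nat k \<in> T" using \<open>0 \<in> T\<close> by simp
  then have i: "w - of_nat i \<in> T" unfolding i_def by (rule LeastI)
  have i_least: "w - of_nat a \<notin> T" if "a < i" for a
    using not_less_Least[of a "\<lambda>i. w - of_nat i \<in> T"] that unfolding i_def by simp
  define u where "u = w - of_nat i"
  have "u \<in> T" using i by (simp add: u_def)
  \<comment> \<open>Between \<open>u\<close> and \<open>w\<close> the minimality of \<open>i\<close>
    keeps \<open>T\<close> away; from \<open>w\<close> on, \<open>a - i < H\<close> stays inside the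
    gap.\<close>
  have u: "u + of_nat a \<notin> T" if "0 < a" "a < H" for a
  proof (cases "a < i")
    case True
    have "u + of_nat a = w - of_nat (i - a)" using True by (simp add: u_def of_nat_diff)
    moreover have "w - of_nat (i - a) \<notin> T" using True that by (intro i_least) simp
    ultimately show ?thesis by metis
  next
    case False
    then have "u + of_nat a = w + of_nat (a - i)" by (simp add: u_def of_nat_diff)
    then show ?thesis using w[of "a - i"] that by simp
  qed
  define m where "m = Max J"
  have "m \<in> J" using \<open>finite J\<close> J(2) by (simp add: m_def)
  define Q where "Q = shift_poly (u + of_nat m) P"
  have Q_dvd: "Q dvd shift_poly (of_nat h) f \<longleftrightarrow> u + of_nat (m - h) \<in> T" if "h \<in> J" for h
  proof -
    have "h \<le> m" using that \<open>finite J\<close> by (simp add: m_def)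
    then have "Q = shift_poly (of_nat h) (shift_poly (u + of_nat (m - h)) P)"
      by (simp add: Q_def of_nat_diff)
    then show ?thesis by (simp only: shift_poly_dvd_iff T_def mem_Collect_eq)
  qed
  have "prime_elem Q" unfolding Q_def by (rule prime_elem_shift_poly) fact
  have "Q dvd shift_poly (of_nat m) f" using Q_dvd[OF \<open>m \<in> J\<close>] \<open>u \<in> T\<close> by simp
  then obtain A where A: "shift_poly (of_nat m) f = Q * A" by (rule dvdE)
  have "\<not> Q dvd A"
  proof
    assume "Q dvd A"
    then have "Q * Q dvd shift_poly (of_nat m) f" unfolding A by simp
    moreover have "Q * Q = shift_poly (of_nat m) (shift_poly u P * shift_poly u P)"
      by (simp add: Q_def shift_poly_mult add.commute)
    ultimately have "shift_poly u P * shift_poly u P dvd f" by (simp only: shift_poly_dvd_iff)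
    then show False using sqf[of "shift_poly u P"] \<open>degree P \<noteq> 0\<close> by simp
  qed
  let ?R = "\<Prod>j\<in>J - {m}. shift_poly (of_nat j) f"
  have "\<not> Q dvd shift_poly (of_nat h) f" if "h \<in> J - {m}" for h
  proof -
    have "h \<le> m" using that \<open>finite J\<close> by (simp add: m_def)
    moreover have "m < H" using J(1) \<open>m \<in> J\<close> by auto
    ultimately have "u + of_nat (m - h) \<notin> T" using that by (intro u) auto
    then show ?thesis using that Q_dvd[of h] by blast
  qed
  then have "\<not> Q dvd ?R"
    using \<open>prime_elem Q\<close> \<open>finite J\<close> by (intro prime_elem_not_dvd_prod) auto
  with \<open>\<not> Q dvd A\<close> \<open>prime_elem Q\<close> have "\<not> Q dvd A * ?R" by (simp add: prime_elem_dvd_mult_iff)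
  then have "nonsquare_poly (Q * (A * ?R))"
    using \<open>prime_elem Q\<close> by (intro nonsquare_poly_if_simple_prime_factor)
  then show ?thesis
    using \<open>finite J\<close> \<open>m \<in> J\<close> by (simp add: prod.remove[of J m] A mult.assoc)
qed

subsection \<open>Transfer to Legendre symbols\<close>

lemma of_int_mod_ring_eq_iff:
  "(of_int x :: 'a::prime_card mod_ring) = of_int y \<longleftrightarrow> x mod int CARD('a) = y mod int CARD('a)"
  by (simp add: of_int_eq_iff_cong_CHAR cong_def)

lemma of_int_poly_eq_iff_Mp:
  "(map_poly of_int F :: 'a::prime_card mod_ring poly) = map_poly of_int G
    \<longleftrightarrow> poly_mod.Mp (int CARD('a)) F = poly_mod.Mp (int CARD('a)) G"
  by (simp add: poly_eq_iff coeff_map_poly poly_mod.Mp_coeff poly_mod.M_def of_int_mod_ring_eq_iff)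

lemma degree_of_int_poly:
  "degree (map_poly of_int F :: 'a::prime_card mod_ring poly) = poly_mod.degree_m (int CARD('a)) F"
proof -
  have "coeff (map_poly of_int F :: 'a mod_ring poly) i = 0
      \<longleftrightarrow> coeff (poly_mod.Mp (int CARD('a)) F) i = 0" for i
    using of_int_mod_ring_eq_iff[of "coeff F i" 0, where 'a='a]
    by (simp add: coeff_map_poly poly_mod.Mp_coeff poly_mod.M_def)
  then show ?thesis by (simp add: degree_def)
qed

lemma of_int_poly_surj: "\<exists>G. (map_poly of_int G :: 'a::prime_card mod_ring poly) = g"
proof
  show "map_poly of_int (map_poly to_int_mod_ring g) = g"
    by (rule poly_eqI) (simp add: coeff_map_poly of_int_of_int_mod_ring)
qed

text \<open>Square-freeness modulo \<open>p\<close> quantifies over integer polynomials, so a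
  divisor over the field is lifted to one before it is excluded.\<close>

lemma square_free_of_int_poly:
  assumes "poly_mod.square_free_m (int CARD('a::prime_card)) F"
  shows "(map_poly of_int F :: 'a mod_ring poly) \<noteq> 0"
    and "degree g \<noteq> 0 \<Longrightarrow> \<not> g * g dvd (map_poly of_int F :: 'a mod_ring poly)"
proof -
  show "(map_poly of_int F :: 'a mod_ring poly) \<noteq> 0"
    using assms of_int_poly_eq_iff_Mp[of F 0, where 'a='a]
    by (simp add: poly_mod.square_free_m_def)
  show "\<not> g * g dvd (map_poly of_int F :: 'a mod_ring poly)" if g: "degree g \<noteq> 0"
  proof
    assume "g * g dvd (map_poly of_int F :: 'a mod_ring poly)"
    then obtain h where h: "map_poly of_int F = g * g * h" by (rule dvdE)
    obtain G where G: "map_poly of_int G = g" using of_int_poly_surj by blast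
    obtain K where K: "map_poly of_int K = h" using of_int_poly_surj by blast
    have "map_poly of_int F = (map_poly of_int (G * G * K) :: 'a mod_ring poly)"
      unfolding h by (simp only: of_int_poly_hom.hom_mult G K)
    then have "poly_mod.dvdm (int CARD('a)) (G * G) F"
      unfolding of_int_poly_eq_iff_Mp poly_mod.dvdm_def by blast
    moreover have "poly_mod.degree_m (int CARD('a)) G \<noteq> 0"
      using g G degree_of_int_poly[of G, where 'a='a] by simp
    ultimately show False using assms by (simp add: poly_mod.square_free_m_def)
  qed
qed

lemma poly_of_int_poly: "poly (map_poly of_int F) (of_int x :: 'a::comm_ring_1) = of_int (poly F x)"
  by (induction F) (simp_all add: map_poly_pCons)

lemma bij_betw_of_nat_mod_ring:
  "bij_betw of_nat {..<CARD('a::prime_card)} (UNIV :: 'a mod_ring set)"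
proof (rule bij_betw_imageI)
  show "inj_on (of_nat :: nat \<Rightarrow> 'a mod_ring) {..<CARD('a)}"
    by (rule inj_onI) (simp add: of_nat_eq_iff_cong_CHAR cong_def)
  show "of_nat ` {..<CARD('a)} = (UNIV :: 'a mod_ring set)"
    using surj_of_nat_mod_ring by (auto simp: image_iff) 
qed

lemma Legendre_values: "Legendre a p = -1 \<or> Legendre a p = 0 \<or> Legendre a p = 1"
  by (simp add: Legendre_def)

lemma prod_Legendre_values:
  fixes f :: "'b \<Rightarrow> int"
  shows "(\<Prod>j\<in>J. Legendre (f j) p) = -1 \<or> (\<Prod>j\<in>J. Legendre (f j) p) = 0 \<or> (\<Prod>j\<in>J. Legendre (f j) p) = 1"
proof (induction J rule: infinite_finite_induct)
  case (insert j J)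
  then show ?case using Legendre_values[of "f j" p] by auto
qed auto

lemma of_int_Legendre:
  assumes "2 < CARD('a::prime_card)"
  shows "(of_int (Legendre a (int CARD('a))) :: 'a mod_ring) = of_int a ^ ((CARD('a) - 1) div 2)"
proof -
  have "[Legendre a (int CARD('a)) = a ^ ((CARD('a) - 1) div 2)] (mod (int CARD('a)))"
    using euler_criterion[OF prime_card[where 'a='a] assms] .
  then show ?thesis
    unfolding of_int_power[symmetric] of_int_mod_ring_eq_iff cong_def .
qed

text \<open>By Euler's criterion the \<open>c\<close>-th power of the value of the product is the
  product of the Legendre symbols, read in the field. That integer is -1, 0 or 1, and these stay
  distinct modulo \<open>p\<close> because \<open>p > 2\<close>.\<close>

lemma prod_Legendre_eq_poly_char:
  fixes F :: "int poly"
  assumes "2 < CARD('a::prime_card)"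
  shows "(\<Prod>j\<in>J. Legendre (poly F (int (k + j))) (int CARD('a))) =
    poly_char ((CARD('a) - 1) div 2)
      (\<Prod>j\<in>J. shift_poly (of_nat j) (map_poly of_int F)) (of_nat k :: 'a mod_ring)"
proof -
  define L where "L = (\<Prod>j\<in>J. Legendre (poly F (int (k + j))) (int CARD('a)))"
  let ?G = "\<Prod>j\<in>J. shift_poly (of_nat j) (map_poly of_int F) :: 'a mod_ring poly"
  let ?c = "(CARD('a) - 1) div 2"
  have "poly (map_poly of_int F) (of_nat j + of_nat k :: 'a mod_ring) = of_int (poly F (int (k + j)))" for j
    using poly_of_int_poly[of F "int (k + j)", where 'a="'a mod_ring"] by (simp add: add.commute)
  then have L: "poly ?G (of_nat k) ^ ?c = of_int L"
    by (simp add: L_def poly_prod poly_shift_poly prod_power_distrib of_int_Legendre[OF assms])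
  have "(of_int 1 :: 'a mod_ring) \<noteq> of_int (-1)" "(of_int 0 :: 'a mod_ring) \<noteq> of_int (-1)"
    using assms unfolding of_int_mod_ring_eq_iff by (simp_all add: zmod_minus1)
  then have "(1 :: 'a mod_ring) \<noteq> -1" by simp
  moreover have "L = -1 \<or> L = 0 \<or> L = 1" unfolding L_def by (rule prod_Legendre_values)
  ultimately show ?thesis
    unfolding poly_char_def L L_def[symmetric] by auto
qed

text \<open>Collects what the analytic part takes from finite fields, as a property of a number
  instead of a type. The products have degree \<open>card J\<close> times that of \<open>F\<close>,
  whence the factor \<open>card J\<close>.\<close>

definition shifted_weil :: "nat \<Rightarrow> bool" where
  "shifted_weil p \<longleftrightarrow> (\<forall>F. poly_mod.square_free_m (int p) F \<longrightarrow> 1 \<le> poly_mod.degree_m (int p) F \<longrightarrow>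
     (\<forall>J H. J \<subseteq> {..<H} \<longrightarrow> J \<noteq> {} \<longrightarrow> H * poly_mod.degree_m (int p) F < p \<longrightarrow>
       \<bar>real_of_int (\<Sum>k<p. \<Prod>j\<in>J. Legendre (poly F (int (k + j))) (int p))\<bar>
         \<le> 27 * poly_mod.degree_m (int p) F * card J * sqrt p) \<and>
     card {k\<in>{..<p}. Legendre (poly F (int k)) (int p) = 0} \<le> poly_mod.degree_m (int p) F)"

lemma shifted_weil_CARD:
  assumes "2 < CARD('a::prime_card)"
  shows "shifted_weil CARD('a)"
  unfolding shifted_weil_def
proof (intro allI impI conjI)
  fix F assume sqf: "poly_mod.square_free_m (int CARD('a)) F"
    and deg: "1 \<le> poly_mod.degree_m (int CARD('a)) F"
  let ?d = "poly_mod.degree_m (int CARD('a)) F"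
  let ?c = "(CARD('a) - 1) div 2"
  define f where "f = (map_poly of_int F :: 'a mod_ring poly)"
  have d: "degree f = ?d" unfolding f_def by (rule degree_of_int_poly)
  have f: "f \<noteq> 0" "\<And>g. degree g \<noteq> 0 \<Longrightarrow> \<not> g * g dvd f"
    unfolding f_def using square_free_of_int_poly[OF sqf] by auto
  have "odd CARD('a)" using prime_card[where 'a='a] assms by (rule prime_odd_nat)
  then have c: "CHAR('a mod_ring) = 2 * ?c + 1" "?c > 0" using assms by (auto elim!: oddE)
  show "card {k\<in>{..<CARD('a)}. Legendre (poly F (int k)) (int CARD('a)) = 0} \<le> ?d"
  proof -
    have "Legendre (poly F (int k)) (int CARD('a)) = 0 \<longleftrightarrow> poly f (of_nat k) = 0" for k
      using poly_of_int_poly[of F "int k", where 'a="'a mod_ring"]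
        of_int_mod_ring_eq_iff[of "poly F (int k)" 0, where 'a='a]
      by (simp add: Legendre_def f_def cong_def)
    then have "of_nat ` {k\<in>{..<CARD('a)}. Legendre (poly F (int k)) (int CARD('a)) = 0}
       \<subseteq> {x. poly f x = 0}" by auto
    then have "card (of_nat ` {k\<in>{..<CARD('a)}. Legendre (poly F (int k)) (int CARD('a)) = 0} :: 'a mod_ring set)
      \<le> card {x. poly f x = 0}" by (intro card_mono) auto
    moreover have "inj_on (of_nat :: nat \<Rightarrow> 'a mod_ring) {k\<in>{..<CARD('a)}. Legendre (poly F (int k)) (int CARD('a)) = 0}"
      using bij_betw_of_nat_mod_ring[where 'a='a] by (auto simp: bij_betw_def intro: inj_on_subset)
    ultimately show ?thesis
      using card_poly_roots_bound[OF f(1)] d by (simp add: card_image)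
  qed
  fix J H assume J: "J \<subseteq> {..<H}" "J \<noteq> {}" "H * ?d < CARD('a)"
  let ?G = "\<Prod>j\<in>J. shift_poly (of_nat j) f"
  have "finite J" using J(1) finite_subset by blast
  have "nonsquare_poly ?G"
    using f(2) J deg unfolding d[symmetric] by (intro nonsquare_poly_prod_shifts) auto
  have degG: "degree ?G = card J * ?d"
    using f(1) d by (subst degree_prod_eq_sum_degree) auto
  have "(\<Sum>k<CARD('a). \<Prod>j\<in>J. Legendre (poly F (int (k + j))) (int CARD('a)))
     = (\<Sum>k<CARD('a). poly_char ?c ?G (of_nat k))"
    unfolding f_def by (intro sum.cong refl prod_Legendre_eq_poly_char assms)
  also have "\<dots> = (\<Sum>x\<in>UNIV. poly_char ?c ?G x)"
    by (rule sum.reindex_bij_betw[OF bij_betw_of_nat_mod_ring])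
  finally have eq: "(\<Sum>k<CARD('a). \<Prod>j\<in>J. Legendre (poly F (int (k + j))) (int CARD('a)))
     = (\<Sum>x\<in>UNIV. poly_char ?c ?G x)" .
  have "degree ?G > 0" using degG deg J(2) \<open>finite J\<close> by (simp add: card_gt_0_iff)
  then show "\<bar>real_of_int (\<Sum>k<CARD('a). \<Prod>j\<in>J. Legendre (poly F (int (k + j))) (int CARD('a)))\<bar>
      \<le> 27 * ?d * card J * sqrt CARD('a)"
    using weil_bound[OF _ c \<open>nonsquare_poly ?G\<close>] unfolding eq degG by (simp add: mult_ac)
qed

text \<open>
  \<open>shifted_weil\<close> is proved for the cardinality of a type, so a type is needed whose cardinality is
  an arbitrary prime. It suffices to have one for a single prime, chosen as a counterexample
  whenever there is one.
\<close>

definition critical_prime :: nat where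
  "critical_prime = (SOME p. prime p \<and> 2 < p \<and> (shifted_weil p \<longrightarrow> (\<forall>q. prime q \<longrightarrow> 2 < q \<longrightarrow> shifted_weil q)))"

lemma critical_prime:
  "prime critical_prime" "2 < critical_prime"
  "shifted_weil critical_prime \<Longrightarrow> prime q \<Longrightarrow> 2 < q \<Longrightarrow> shifted_weil q"
proof -
  obtain p :: nat where "prime p" "2 < p" using bigger_prime by blast
  then have "\<exists>p. prime p \<and> 2 < p \<and> (shifted_weil p \<longrightarrow> (\<forall>q. prime q \<longrightarrow> 2 < q \<longrightarrow> shifted_weil q))"
    by (cases "\<forall>q. prime q \<longrightarrow> 2 < q \<longrightarrow> shifted_weil q") auto
  from someI_ex[OF this] show "prime critical_prime" "2 < critical_prime"
    "shifted_weil critical_prime \<Longrightarrow> prime q \<Longrightarrow> 2 < q \<Longrightarrow> shifted_weil q"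
    unfolding critical_prime_def by blast+
qed

typedef critical_index = "{..<critical_prime}"
  using critical_prime(2) by (intro exI[of _ 0]) simp

lemma CARD_critical_index: "CARD(critical_index) = critical_prime"
  using type_definition.card[OF type_definition_critical_index] by simp

instance critical_index :: prime_card
  by standard (simp add: CARD_critical_index critical_prime)

lemma shifted_weil_prime:
  assumes "prime q" "2 < q"
  shows "shifted_weil q"
  using critical_prime(3)[OF _ assms] shifted_weil_CARD[where 'a=critical_index] critical_prime(2)
  by (simp add: CARD_critical_index)

subsection \<open>Exponential sums along a walk with pseudorandom signs\<close>

lemma sum_periodic_shift:
  fixes g :: "nat \<Rightarrow> 'a::comm_monoid_add"
  assumes "\<And>k. g (k + p) = g k"
  shows "(\<Sum>k<p. g (k + h)) = (\<Sum>k<p. g k)"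
proof (induction h)
  case (Suc h)
  have "(\<Sum>k<p. g (k + Suc h)) = (\<Sum>k<p. g (k + h))"
  proof (cases p)
    case (Suc q)
    then have "g (Suc q + h) = g h" using assms[of h] by (simp add: add.commute)
    then show ?thesis
      using sum.lessThan_Suc[of "\<lambda>k. g (k + Suc h)" q] sum.lessThan_Suc_shift[of "\<lambda>k. g (k + h)" q]
      by (simp add: Suc add.commute)
  qed simp
  with Suc.IH show ?case by simp
qed simp

text \<open>Each unit shift exchanges one boundary term for another. This replaces periodicity,
  which the phases of the walk need not have even though the signs do: the walk may end a period
  away from 0.\<close>

lemma norm_sum_shift_diff_le:
  fixes u :: "nat \<Rightarrow> 'a::real_normed_vector"
  assumes "\<And>k. norm (u k) \<le> 1"
  shows "norm ((\<Sum>k<p. u (k + h)) - (\<Sum>k<p. u k)) \<le> 2 * real h"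
proof (induction h)
  case (Suc h)
  have "(\<Sum>k<p. u (k + Suc h)) - (\<Sum>k<p. u (k + h)) = u (p + h) - u h"
    using sum_lessThan_telescope[of "\<lambda>k. u (k + h)" p] by (simp add: sum_subtractf)
  moreover have "norm (u (p + h) - u h) \<le> 2"
    using norm_triangle_ineq4[of "u (p + h)" "u h"] assms[of "p + h"] assms[of h] by linarith
  ultimately have "norm ((\<Sum>k<p. u (k + Suc h)) - (\<Sum>k<p. u (k + h))) \<le> 2" by simp
  moreover have "norm ((\<Sum>k<p. u (k + Suc h)) - (\<Sum>k<p. u k))
     \<le> norm ((\<Sum>k<p. u (k + Suc h)) - (\<Sum>k<p. u (k + h))) + norm ((\<Sum>k<p. u (k + h)) - (\<Sum>k<p. u k))"
    using norm_triangle_ineq[of "(\<Sum>k<p. u (k + Suc h)) - (\<Sum>k<p. u (k + h))"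
        "(\<Sum>k<p. u (k + h)) - (\<Sum>k<p. u k)"] by simp
  ultimately show ?case using Suc.IH by simp
qed simp

text \<open>Applied to the distances from a fixed \<open>h\<close> to the indices on one side of it,
  which are distinct.\<close>

lemma sum_power_inj_le:
  fixes q :: real
  assumes "0 \<le> q" "q < 1" "finite A" "inj_on g A"
  shows "(\<Sum>a\<in>A. q ^ g a) \<le> 1 / (1 - q)"
proof -
  have "(\<Sum>a\<in>A. q ^ g a) = (\<Sum>i\<in>g ` A. q ^ i)" using assms(4) by (simp add: sum.reindex)
  also have "\<dots> \<le> (\<Sum>i. q ^ i)"
    using assms by (intro sum_le_suminf summable_geometric) auto
  also have "\<dots> = 1 / (1 - q)" using assms by (simp add: suminf_geometric)
  finally show ?thesis .
qed

lemma cis_sum: "cis (\<Sum>j\<in>A. f j) = (\<Prod>j\<in>A. cis (f j))"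
  by (induction A rule: infinite_finite_induct) (simp_all add: cis_mult[symmetric])

text \<open>\<open>H\<close> limits the length of blocks in which the signs look independent, and
  \<open>E\<close> is the error in each correlation. Zero signs are counted by \<open>d\<close>
  because \<open>cis (\<theta> * x) = cos \<theta> + i x sin \<theta>\<close> holds for signs 1 and
  -1 but may fail for 0.\<close>

locale pseudorandom_signs =
  fixes x :: "nat \<Rightarrow> int" and p H d :: nat and E :: real
  assumes sign_values: "x n = -1 \<or> x n = 0 \<or> x n = 1"
    and periodic: "x (n + p) = x n"
    and zeros: "card {k\<in>{..<p}. x k = 0} \<le> d"
    and correlation: "J \<subseteq> {..<H} \<Longrightarrow> J \<noteq> {} \<Longrightarrow> \<bar>real_of_int (\<Sum>k<p. \<Prod>j\<in>J. x (k + j))\<bar> \<le> E"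
    and H_pos: "H > 0" and p_pos: "p > 0" and E_nonneg: "E \<ge> 0"
begin

lemma zeros_shift: "card {k\<in>{..<p}. x (k + h) = 0} \<le> d"
proof -
  have "int (card {k\<in>{..<p}. x (k + h) = 0}) = (\<Sum>k<p. if x (k + h) = 0 then 1 else 0)"
    by (simp add: sum.If_cases Int_def)
  also have "\<dots> = (\<Sum>k<p. if x k = 0 then 1 else 0)"
    by (rule sum_periodic_shift[where g="\<lambda>k. if x k = 0 then 1 else 0"]) (simp add: periodic)
  also have "\<dots> = int (card {k\<in>{..<p}. x k = 0})"
    by (simp add: sum.If_cases Int_def)
  finally show ?thesis using zeros by simp
qed

lemma zeros_block: "card {k\<in>{..<p}. \<exists>j<L. x (k + j) = 0} \<le> L * d"
proof -
  have "{k\<in>{..<p}. \<exists>j<L. x (k + j) = 0} = (\<Union>j<L. {k\<in>{..<p}. x (k + j) = 0})" by auto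
  then have "card {k\<in>{..<p}. \<exists>j<L. x (k + j) = 0} \<le> (\<Sum>j<L. card {k\<in>{..<p}. x (k + j) = 0})"
    using card_UN_le[of "{..<L}" "\<lambda>j. {k\<in>{..<p}. x (k + j) = 0}"] by simp
  also have "\<dots> \<le> (\<Sum>j<L. d)" by (intro sum_mono zeros_shift)
  finally show ?thesis by simp
qed

text \<open>Multiplying out, the empty subset of the block gives the main term, and every other
  subset gives a correlation with a coefficient of modulus at most 1. The number of subsets is the
  reason for the factor \<open>2 ^ L\<close>.\<close>

lemma product_expansion_bound:
  assumes "L \<le> H"
  shows "norm ((\<Sum>k<p. \<Prod>j<L. complex_of_real (cos \<theta>) + \<i> * of_int (x (k + j)) * complex_of_real (sin \<theta>))
    - p * complex_of_real (cos \<theta>) ^ L) \<le> 2 ^ L * E"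
proof -
  let ?c = "complex_of_real (cos \<theta>)" and ?s = "\<i> * complex_of_real (sin \<theta>)"
  have "(\<Prod>j<L. ?c + \<i> * of_int (x (k + j)) * complex_of_real (sin \<theta>))
      = (\<Sum>J\<in>Pow {..<L}. ?c ^ card ({..<L} - J) * ?s ^ card J * of_int (\<Prod>j\<in>J. x (k + j)))" for k
  proof -
    have "(\<Prod>j<L. ?c + \<i> * of_int (x (k + j)) * complex_of_real (sin \<theta>)) = (\<Prod>j<L. ?s * of_int (x (k + j)) + ?c)"
      by (simp add: algebra_simps)
    also have "\<dots> = (\<Sum>J\<in>Pow {..<L}. (\<Prod>j\<in>J. ?s * of_int (x (k + j))) * (\<Prod>j\<in>{..<L} - J. ?c))"
      by (rule prod_add) simp
    finally show ?thesis by (simp add: prod.distrib algebra_simps)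
  qed
  then have "(\<Sum>k<p. \<Prod>j<L. ?c + \<i> * of_int (x (k + j)) * complex_of_real (sin \<theta>))
      = (\<Sum>J\<in>Pow {..<L}. \<Sum>k<p. ?c ^ card ({..<L} - J) * ?s ^ card J * of_int (\<Prod>j\<in>J. x (k + j)))"
    by (simp only: sum.swap[of _ "{..<p}"])
  also have "\<dots> = (\<Sum>J\<in>Pow {..<L}. ?c ^ card ({..<L} - J) * ?s ^ card J
      * of_int (\<Sum>k<p. \<Prod>j\<in>J. x (k + j)))"
    by (simp add: sum_distrib_left)
  also have "\<dots> = p * ?c ^ L + (\<Sum>J\<in>Pow {..<L} - {{}}. ?c ^ card ({..<L} - J) * ?s ^ card J
      * of_int (\<Sum>k<p. \<Prod>j\<in>J. x (k + j)))"
    by (subst sum.remove[of _ "{}"]) (auto simp: algebra_simps)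
  finally have "(\<Sum>k<p. \<Prod>j<L. ?c + \<i> * of_int (x (k + j)) * complex_of_real (sin \<theta>)) - p * ?c ^ L
    = (\<Sum>J\<in>Pow {..<L} - {{}}. ?c ^ card ({..<L} - J) * ?s ^ card J * of_int (\<Sum>k<p. \<Prod>j\<in>J. x (k + j)))"
    by simp
  also have "norm \<dots> \<le> (\<Sum>J\<in>Pow {..<L} - {{}}. E)"
  proof (intro order.trans[OF norm_sum] sum_mono)
    fix J assume J: "J \<in> Pow {..<L} - {{}}"
    have "norm (?c ^ card ({..<L} - J) * ?s ^ card J) \<le> 1"
      unfolding norm_mult norm_power
      by (intro mult_le_one power_le_one zero_le_power norm_ge_zero) (simp_all add: norm_mult)
    moreover have "norm (of_int (\<Sum>k<p. \<Prod>j\<in>J. x (k + j)) :: complex) \<le> E"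
      unfolding norm_of_int using J assms by (intro correlation) auto
    ultimately show "norm (?c ^ card ({..<L} - J) * ?s ^ card J * of_int (\<Sum>k<p. \<Prod>j\<in>J. x (k + j))) \<le> E"
      unfolding norm_mult[of "?c ^ card ({..<L} - J) * ?s ^ card J"]
      using mult_mono[of "norm (?c ^ card ({..<L} - J) * ?s ^ card J)" 1
          "norm (of_int (\<Sum>k<p. \<Prod>j\<in>J. x (k + j)) :: complex)" E] by simp
  qed
  also have "\<dots> = real (card (Pow {..<L} - {{}})) * E" by simp
  also have "\<dots> \<le> 2 ^ L * E"
    using E_nonneg by (intro mult_right_mono) (simp_all add: card_Diff_singleton card_Pow of_nat_diff)
  finally show ?thesis .
qed

text \<open>The summand equals the product of linear factors unless a zero sign lies in the block.
  This happens for at most \<open>L * d\<close> values of \<open>k\<close>, each costing at most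
  2.\<close>

lemma block_sum_bound:
  assumes "L \<le> H"
  shows "norm ((\<Sum>k<p. cis (\<theta> * of_int (\<Sum>j<L. x (k + j)))) - p * complex_of_real (cos \<theta>) ^ L)
    \<le> 2 * H * d + 2 ^ H * E"
proof -
  let ?w = "\<lambda>k. \<Prod>j<L. complex_of_real (cos \<theta>) + \<i> * of_int (x (k + j)) * complex_of_real (sin \<theta>)"
  let ?v = "\<lambda>k. cis (\<theta> * of_int (\<Sum>j<L. x (k + j)))"
  let ?Z = "{k\<in>{..<p}. \<exists>j<L. x (k + j) = 0}"
  have v: "?v k = (\<Prod>j<L. cis (\<theta> * of_int (x (k + j))))" for k
    by (simp add: sum_distrib_left cis_sum)
  have diff: "norm (?v k - ?w k) \<le> (if k \<in> ?Z then 2 else 0)" if "k < p" for k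
  proof (cases "k \<in> ?Z")
    case True
    have "norm (?w k) \<le> (\<Prod>j<L. 1)"
      unfolding prod_norm[symmetric]
    proof (intro prod_mono conjI norm_ge_zero)
      fix j
      have "complex_of_real (cos \<theta>) + \<i> * of_int (x (k + j)) * complex_of_real (sin \<theta>) = Complex (cos \<theta>) (x (k + j) * sin \<theta>)"
        by (simp add: complex_eq_iff)
      moreover have "cmod (Complex (cos \<theta>) (x (k + j) * sin \<theta>)) \<le> 1"
        using sign_values[of "k + j"] abs_cos_le_one[of \<theta>]
        by (auto simp: cmod_def power_mult_distrib abs_square_le_1)
      ultimately show "norm (complex_of_real (cos \<theta>) + \<i> * of_int (x (k + j)) * complex_of_real (sin \<theta>)) \<le> 1" by simp
    qed
    then show ?thesis
      using True norm_triangle_ineq4[of "?v k" "?w k"] by simp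
  next
    case False
    have "cis (\<theta> * of_int (x (k + j))) = complex_of_real (cos \<theta>) + \<i> * of_int (x (k + j)) * complex_of_real (sin \<theta>)"
      if "j < L" for j
      using sign_values[of "k + j"] False that \<open>k < p\<close> by (auto simp: complex_eq_iff)
    then have "?v k = ?w k" unfolding v by (intro prod.cong) auto
    then show ?thesis using False by simp
  qed
  have "norm ((\<Sum>k<p. ?v k) - (\<Sum>k<p. ?w k)) \<le> (\<Sum>k<p. norm (?v k - ?w k))"
    unfolding sum_subtractf[symmetric] by (rule norm_sum)
  also have "\<dots> \<le> (\<Sum>k<p. if k \<in> ?Z then 2 else 0)"
    using diff by (intro sum_mono) auto
  also have "\<dots> = 2 * real (card ?Z)"
    by (subst sum.inter_restrict[symmetric]) (auto simp: Int_def)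
  also have "\<dots> \<le> 2 * real (H * d)"
  proof -
    have "card ?Z \<le> H * d" using zeros_block[of L] mult_le_mono1[OF assms, of d] by (rule order.trans)
    then show ?thesis by (simp only: of_nat_mono mult_left_mono zero_le_numeral)
  qed
  finally have 1: "norm ((\<Sum>k<p. ?v k) - (\<Sum>k<p. ?w k)) \<le> 2 * H * d" by simp
  have "2 ^ L * E \<le> 2 ^ H * E" using assms E_nonneg by (intro mult_right_mono power_increasing) auto
  then have 2: "norm ((\<Sum>k<p. ?w k) - p * complex_of_real (cos \<theta>) ^ L) \<le> 2 ^ H * E"
    using product_expansion_bound[OF assms, of \<theta>] by linarith
  show ?thesis
    using norm_triangle_ineq[of "(\<Sum>k<p. ?v k) - (\<Sum>k<p. ?w k)" "(\<Sum>k<p. ?w k) - p * complex_of_real (cos \<theta>) ^ L"]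
      1 2 by simp
qed

section \<open>Averaging over shifts for the phases of the walk\<close>

definition walk :: "nat \<Rightarrow> int" where "walk k = (\<Sum>n = 1..k. x n)"

text \<open>The index is moved by one so that \<open>k < p\<close> runs through the partial sums up
  to \<open>1, ..., p\<close>.\<close>

definition phase :: "real \<Rightarrow> nat \<Rightarrow> complex" where "phase \<theta> k = cis (\<theta> * of_int (walk (Suc k)))"

lemma walk_add: "walk (k + L) = walk k + (\<Sum>j<L. x (k + 1 + j))"
  by (induction L) (simp_all add: walk_def add.assoc)

lemma norm_phase [simp]: "norm (phase \<theta> k) = 1"
  by (simp add: phase_def)

text \<open>The common past of the walk cancels, leaving the \<open>h - h'\<close> signs between the
  two times. Their starting offset \<open>h' + 2\<close> disappears by periodicity of the
  signs.\<close>

lemma phase_correlation_bound: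
  assumes "h' \<le> h" "h < H"
  shows "norm (\<Sum>k<p. phase \<theta> (k + h) * cnj (phase \<theta> (k + h')))
    \<le> p * \<bar>cos \<theta>\<bar> ^ (h - h') + (2 * H * d + 2 ^ H * E)"
proof -
  let ?L = "h - h'"
  have "phase \<theta> (k + h) * cnj (phase \<theta> (k + h')) = cis (\<theta> * of_int (\<Sum>j<?L. x (k + (h' + 2) + j)))" for k
  proof -
    have "walk (Suc (k + h)) = walk (Suc (k + h')) + (\<Sum>j<?L. x (Suc (k + h') + 1 + j))"
      using walk_add[of "Suc (k + h')" ?L] assms(1) by simp
    then show ?thesis
      by (simp add: phase_def cis_cnj cis_mult algebra_simps)
  qed
  then have "(\<Sum>k<p. phase \<theta> (k + h) * cnj (phase \<theta> (k + h')))
      = (\<Sum>k<p. cis (\<theta> * of_int (\<Sum>j<?L. x (k + (h' + 2) + j))))" by simp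
  also have "\<dots> = (\<Sum>k<p. cis (\<theta> * of_int (\<Sum>j<?L. x (k + j))))"
  proof (rule sum_periodic_shift[where g="\<lambda>k. cis (\<theta> * of_int (\<Sum>j<?L. x (k + j)))"])
    fix k
    have "x (k + p + j) = x (k + j)" for j using periodic[of "k + j"] by (simp add: add_ac)
    then show "cis (\<theta> * of_int (\<Sum>j<?L. x (k + p + j))) = cis (\<theta> * of_int (\<Sum>j<?L. x (k + j)))" by simp
  qed
  also have "norm \<dots> \<le> norm (p * complex_of_real (cos \<theta>) ^ ?L) + (2 * H * d + 2 ^ H * E)"
    using norm_triangle_sub[of "\<Sum>k<p. cis (\<theta> * of_int (\<Sum>j<?L. x (k + j)))" "p * complex_of_real (cos \<theta>) ^ ?L"]
      block_sum_bound[of ?L \<theta>] assms(2) by linarith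
  finally show ?thesis by (simp add: norm_mult norm_power)
qed

text \<open>The second moment of the block sums runs over pairs \<open>(h, h')\<close> with main
  terms decaying like \<open>q ^ |h - h'|\<close>. Each row sums to at most
  \<open>2 / (1 - q)\<close> instead of \<open>H\<close>, which is the gain. The term
  \<open>8 H^2\<close> is the boundary cost of the shifts.\<close>

lemma phase_sum_bound:
  assumes "\<bar>cos \<theta>\<bar> < 1"
  shows "(norm (\<Sum>k<p. phase \<theta> k))\<^sup>2
    \<le> (real p)\<^sup>2 * (4 / (H * (1 - \<bar>cos \<theta>\<bar>))) + 2 * p * (2 * H * d + 2 ^ H * E) + 8 * (real H)\<^sup>2"
proof -
  define q where "q = \<bar>cos \<theta>\<bar>"
  define E' where "E' = 2 * H * d + 2 ^ H * E"
  have q: "0 \<le> q" "q < 1" using assms by (auto simp: q_def)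
  let ?u = "phase \<theta>"
  let ?Z = "\<Sum>k<p. ?u k"
  let ?v = "\<lambda>k. \<Sum>h<H. ?u (k + h)"
  define dst where "dst = (\<lambda>h h'::nat. if h' \<le> h then h - h' else h' - h)"
  have corr: "norm (\<Sum>k<p. ?u (k + h) * cnj (?u (k + h'))) \<le> p * q ^ dst h h' + E'"
    if "h < H" "h' < H" for h h'
  proof (cases "h' \<le> h")
    case True
    then show ?thesis using phase_correlation_bound[of h' h \<theta>] that by (simp add: dst_def q_def E'_def)
  next
    case False
    have "(\<Sum>k<p. ?u (k + h) * cnj (?u (k + h'))) = cnj (\<Sum>k<p. ?u (k + h') * cnj (?u (k + h)))"
      by (simp add: mult.commute)
    then have "norm (\<Sum>k<p. ?u (k + h) * cnj (?u (k + h'))) = norm (\<Sum>k<p. ?u (k + h') * cnj (?u (k + h)))"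
      by (simp only: complex_mod_cnj)
    then show ?thesis using phase_correlation_bound[of h h' \<theta>] that False by (simp add: dst_def q_def E'_def)
  qed
  have dst_sum: "(\<Sum>h'<H. q ^ dst h h') \<le> 2 / (1 - q)" for h
  proof -
    have "(\<Sum>h'<H. q ^ dst h h') = (\<Sum>h'\<in>{..<H} \<inter> {..h}. q ^ dst h h') + (\<Sum>h'\<in>{..<H} \<inter> - {..h}. q ^ dst h h')"
      by (subst sum.union_disjoint[symmetric]) (auto intro!: sum.cong)
    also have "\<dots> \<le> 1 / (1 - q) + 1 / (1 - q)"
      using q by (intro add_mono sum_power_inj_le) (auto simp: dst_def inj_on_def)
    finally show ?thesis by simp
  qed
  have "complex_of_real (\<Sum>k<p. (norm (?v k))\<^sup>2) = (\<Sum>k<p. ?v k * cnj (?v k))"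
    by (simp add: complex_norm_square del: of_real_power)
  also have "\<dots> = (\<Sum>k<p. \<Sum>h<H. \<Sum>h'<H. ?u (k + h) * cnj (?u (k + h')))"
    by (simp add: sum_product)
  also have "\<dots> = (\<Sum>h<H. \<Sum>k<p. \<Sum>h'<H. ?u (k + h) * cnj (?u (k + h')))"
    by (rule sum.swap)
  also have "\<dots> = (\<Sum>h<H. \<Sum>h'<H. \<Sum>k<p. ?u (k + h) * cnj (?u (k + h')))"
    by (intro sum.cong refl sum.swap)
  finally have expand: "complex_of_real (\<Sum>k<p. (norm (?v k))\<^sup>2)
     = (\<Sum>h<H. \<Sum>h'<H. \<Sum>k<p. ?u (k + h) * cnj (?u (k + h')))" .
  have "(\<Sum>k<p. (norm (?v k))\<^sup>2) = norm (complex_of_real (\<Sum>k<p. (norm (?v k))\<^sup>2))"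
    unfolding norm_of_real by (intro abs_of_nonneg[symmetric] sum_nonneg) simp
  also have "\<dots> \<le> (\<Sum>h<H. \<Sum>h'<H. norm (\<Sum>k<p. ?u (k + h) * cnj (?u (k + h'))))"
    unfolding expand by (intro order.trans[OF norm_sum] sum_mono norm_sum)
  also have "\<dots> \<le> (\<Sum>h<H. \<Sum>h'<H. p * q ^ dst h h' + E')"
    using corr by (intro sum_mono) auto
  also have "\<dots> = (\<Sum>h<H. p * (\<Sum>h'<H. q ^ dst h h') + H * E')"
    by (simp add: sum.distrib sum_distrib_left)
  also have "\<dots> \<le> (\<Sum>h<H. p * (2 / (1 - q)) + H * E')"
    using dst_sum by (intro sum_mono add_right_mono mult_left_mono) auto
  also have "\<dots> = H * (p * (2 / (1 - q)) + H * E')" by simp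
  finally have second: "(\<Sum>k<p. (norm (?v k))\<^sup>2) \<le> H * (p * (2 / (1 - q)) + H * E')" .
  define W where "W = (\<Sum>k<p. norm (?v k))"
  have W2: "W\<^sup>2 \<le> p * (H * (p * (2 / (1 - q)) + H * E'))"
  proof -
    have "W\<^sup>2 \<le> (\<Sum>k<p. (norm (?v k))\<^sup>2) * card {..<p}"
      unfolding W_def by (rule sum_squared_le_sum_of_squares)
    also have "\<dots> \<le> (H * (p * (2 / (1 - q)) + H * E')) * p"
      unfolding card_lessThan using second by (rule mult_right_mono) simp
    finally show ?thesis by (simp add: mult.commute)
  qed
  have "H * norm ?Z = norm (\<Sum>h<H. ?Z)" by (simp add: norm_mult)
  also have "(\<Sum>h<H. ?Z) = (\<Sum>h<H. \<Sum>k<p. ?u (k + h)) - (\<Sum>h<H. (\<Sum>k<p. ?u (k + h)) - ?Z)"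
    by (simp add: sum_subtractf)
  also have "norm \<dots> \<le> norm (\<Sum>h<H. \<Sum>k<p. ?u (k + h)) + (\<Sum>h<H. norm ((\<Sum>k<p. ?u (k + h)) - ?Z))"
    by (intro order.trans[OF norm_triangle_ineq4] add_left_mono norm_sum)
  also have "(\<Sum>h<H. \<Sum>k<p. ?u (k + h)) = (\<Sum>k<p. ?v k)" by (rule sum.swap)
  also have "norm (\<Sum>k<p. ?v k) \<le> W" unfolding W_def by (rule norm_sum)
  also have "(\<Sum>h<H. norm ((\<Sum>k<p. ?u (k + h)) - ?Z)) \<le> (\<Sum>h<H. 2 * real H)"
  proof (rule sum_mono)
    fix h assume "h \<in> {..<H}"
    moreover have "norm ((\<Sum>k<p. ?u (k + h)) - ?Z) \<le> 2 * real h"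
      by (rule norm_sum_shift_diff_le) simp
    ultimately show "norm ((\<Sum>k<p. ?u (k + h)) - ?Z) \<le> 2 * real H" by simp
  qed
  finally have "H * norm ?Z \<le> W + 2 * (real H)\<^sup>2" by (simp add: power2_eq_square)
  then have "(H * norm ?Z)\<^sup>2 \<le> (W + 2 * (real H)\<^sup>2)\<^sup>2"
    by (intro power_mono) auto
  also have "\<dots> \<le> 2 * W\<^sup>2 + 2 * (2 * (real H)\<^sup>2)\<^sup>2"
    using sum_squares_bound[of W "2 * (real H)\<^sup>2"] unfolding power2_sum by linarith
  also have "\<dots> \<le> 2 * (p * (H * (p * (2 / (1 - q)) + H * E'))) + 8 * (real H)\<^sup>2 * (real H)\<^sup>2"
  proof -
    have "2 * (2 * (real H)\<^sup>2)\<^sup>2 = 8 * (real H)\<^sup>2 * (real H)\<^sup>2"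
      by (simp add: power2_eq_square)
    then show ?thesis using W2 by linarith
  qed
  also have "\<dots> = (real H)\<^sup>2 * ((real p)\<^sup>2 * (4 / (H * (1 - q))) + 2 * p * E' + 8 * (real H)\<^sup>2)"
  proof -
    have "(real H)\<^sup>2 * (4 / (H * (1 - q))) = 2 * (H * (2 / (1 - q)))"
      using H_pos by (simp add: power2_eq_square)
    then have "(real p)\<^sup>2 * ((real H)\<^sup>2 * (4 / (H * (1 - q)))) = (real p)\<^sup>2 * (2 * (H * (2 / (1 - q))))"
      by (simp only:)
    then show ?thesis by (simp only: power2_eq_square ring_distribs mult_ac)
  qed
  finally have "(real H)\<^sup>2 * (norm ?Z)\<^sup>2
      \<le> (real H)\<^sup>2 * ((real p)\<^sup>2 * (4 / (H * (1 - q))) + 2 * p * E' + 8 * (real H)\<^sup>2)"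
    by (simp add: power_mult_distrib)
  then show ?thesis using H_pos unfolding q_def E'_def by (subst (asm) mult_le_cancel_left_pos) auto
qed

text \<open>Each nonzero sign flips the phase, so the sum and its shift by one nearly cancel; yet
  they differ by at most 2. Subtracting the two relations isolates twice the sum.\<close>

lemma phase_sum_bound_alternating:
  assumes "cos \<theta> = -1"
  shows "norm (\<Sum>k<p. phase \<theta> k) \<le> d + 1"
proof -
  let ?u = "phase \<theta>" and ?N = "{k\<in>{..<p}. x (k + 2) = 0}"
  have "sin \<theta> = 0" using assms sin_cos_squared_add[of \<theta>] by simp
  then have cis: "cis \<theta> = -1" "cis (- \<theta>) = -1" using assms by (simp_all add: complex_eq_iff)
  have step: "norm (?u k + ?u (k + 1)) \<le> (if k \<in> ?N then 2 else 0)" if "k < p" for k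
  proof -
    have "walk (Suc (k + 1)) = walk (Suc k) + x (k + 2)"
      using walk_add[of "Suc k" 1] by (simp add: numeral_2_eq_2)
    then have "?u (k + 1) = ?u k * cis (\<theta> * of_int (x (k + 2)))"
      by (simp add: phase_def cis_mult distrib_left)
    then have "?u (k + 1) = - ?u k" if "k \<notin> ?N"
      using sign_values[of "k + 2"] that \<open>k < p\<close> cis by auto
    then show ?thesis using norm_triangle_ineq[of "?u k" "?u (k + 1)"] by simp
  qed
  let ?Z = "\<Sum>k<p. ?u k"
  have "norm (\<Sum>k<p. ?u k + ?u (k + 1)) \<le> (\<Sum>k<p. if k \<in> ?N then 2 else 0)"
    using step by (intro order.trans[OF norm_sum] sum_mono) auto
  also have "\<dots> = 2 * real (card ?N)"
    by (subst sum.inter_restrict[symmetric]) (auto simp: Int_def)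
  also have "\<dots> \<le> 2 * d" using zeros_shift[of 2] by simp
  finally have "norm (?Z + (\<Sum>k<p. ?u (k + 1))) \<le> 2 * d" by (simp add: sum.distrib)
  moreover have "norm ((\<Sum>k<p. ?u (k + 1)) - ?Z) \<le> 2"
    using norm_sum_shift_diff_le[where u = ?u and p = p and h = 1] by simp
  moreover have "2 * norm ?Z = norm ((?Z + (\<Sum>k<p. ?u (k + 1))) - ((\<Sum>k<p. ?u (k + 1)) - ?Z))"
  proof -
    have "(?Z + (\<Sum>k<p. ?u (k + 1))) - ((\<Sum>k<p. ?u (k + 1)) - ?Z) = 2 * ?Z" by simp
    then show ?thesis by (simp only: norm_mult) simp
  qed
  ultimately have "2 * norm ?Z \<le> 2 * real d + 2"
    using norm_triangle_ineq4[of "?Z + (\<Sum>k<p. ?u (k + 1))" "(\<Sum>k<p. ?u (k + 1)) - ?Z"] by linarith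
  then show ?thesis by simp
qed

end

subsection \<open>Distribution of the walk modulo \<open>m\<close>\<close>

lemma sum_cis_multiples:
  fixes t :: int
  assumes "m > 0"
  shows "(\<Sum>b<m. cis (2 * pi * real b / real m * of_int t)) = (if int m dvd t then of_nat m else 0)"
proof -
  define z where "z = cis (2 * pi * of_int t / real m)"
  have pow: "cis (2 * pi * real b / real m * of_int t) = z ^ b" for b
    by (simp add: z_def Complex.DeMoivre algebra_simps)
  show ?thesis
  proof (cases "int m dvd t")
    case True
    then obtain q where "t = int m * q" by (elim dvdE)
    then have "z = cis (2 * pi * of_int q)"
      using assms by (simp add: z_def mult.assoc del: cis_multiple_2pi)
    also have "\<dots> = 1" by (rule cis_multiple_2pi) simp
    finally have "z = 1" .
    then show ?thesis unfolding pow using True by simp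
  next
    case False
    have "z \<noteq> 1"
    proof
      assume "z = 1"
      then have "cos (2 * pi * of_int t / real m) = 1" by (simp add: z_def complex_eq_iff)
      then obtain n :: int where "2 * pi * real_of_int t / real m = real_of_int n * 2 * pi"
        unfolding cos_one_2pi_int by blast
      then have "real_of_int t = real_of_int (n * int m)" using assms by (simp add: field_simps)
      then have "t = n * int m" by (simp only: of_int_eq_iff)
      then show False using False by simp
    qed
    moreover have "z ^ m = 1"
      using assms by (simp add: z_def Complex.DeMoivre cis_multiple_2pi)
    ultimately show ?thesis unfolding pow using False by (simp add: geometric_sum)
  qed
qed

lemma sum_indicator_residue:
  fixes t :: int
  assumes "m > 0"
  shows "(\<Sum>a<m. (if [t = int a] (mod int m) then 1 else 0) * g a) = (g (nat (t mod int m)) :: real)"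
proof -
  have "[t = int a] (mod int m) \<longleftrightarrow> a = nat (t mod int m)" if "a < m" for a
    using that by (auto simp: cong_def nat_eq_iff)
  then have "(\<Sum>a<m. (if [t = int a] (mod int m) then 1 else 0) * g a)
      = (\<Sum>a<m. if a = nat (t mod int m) then g a else 0)"
    by (intro sum.cong) auto
  also have "\<dots> = g (nat (t mod int m))"
    using assms by (simp add: nat_less_iff)
  finally show ?thesis .
qed

text \<open>Both sides equal \<open>m\<close> times the number of pairs \<open>(k, k')\<close> with
  \<open>s k\<close> and \<open>s k'\<close> congruent modulo \<open>m\<close>.\<close>

lemma residue_count_parseval:
  fixes s :: "'b \<Rightarrow> int"
  assumes "finite A" "m > 0"
  shows "real m * (\<Sum>a<m. (real (card {k\<in>A. [s k = int a] (mod int m)}))\<^sup>2)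
    = (\<Sum>b<m. (norm (\<Sum>k\<in>A. cis (2 * pi * real b / real m * of_int (s k))))\<^sup>2)"
proof -
  let ?e = "\<lambda>b k. cis (2 * pi * real b / real m * of_int (s k))"
  let ?I = "\<lambda>k a. if [s k = int a] (mod int m) then 1 else (0::real)"
  have count: "real (card {k\<in>A. [s k = int a] (mod int m)}) = (\<Sum>k\<in>A. ?I k a)" for a
    using assms(1) by (simp add: sum.If_cases Int_def)
  have "(\<Sum>a<m. (real (card {k\<in>A. [s k = int a] (mod int m)}))\<^sup>2)
      = (\<Sum>a<m. \<Sum>k\<in>A. \<Sum>k'\<in>A. ?I k a * ?I k' a)"
    unfolding count power2_eq_square sum_product ..
  also have "\<dots> = (\<Sum>k\<in>A. \<Sum>a<m. \<Sum>k'\<in>A. ?I k a * ?I k' a)" by (rule sum.swap)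
  also have "\<dots> = (\<Sum>k\<in>A. \<Sum>k'\<in>A. \<Sum>a<m. ?I k a * ?I k' a)" by (intro sum.cong refl sum.swap)
  also have "\<dots> = (\<Sum>k\<in>A. \<Sum>k'\<in>A. if int m dvd (s k - s k') then 1 else 0)"
  proof (intro sum.cong refl)
    fix k k'
    show "(\<Sum>a<m. ?I k a * ?I k' a) = (if int m dvd (s k - s k') then 1 else 0)"
      unfolding sum_indicator_residue[OF assms(2)]
      using assms(2) by (simp add: cong_def mod_eq_dvd_iff[symmetric] eq_commute)
  qed
  finally have lhs: "(\<Sum>a<m. (real (card {k\<in>A. [s k = int a] (mod int m)}))\<^sup>2)
    = (\<Sum>k\<in>A. \<Sum>k'\<in>A. if int m dvd (s k - s k') then 1 else 0)" .
  have "complex_of_real (\<Sum>b<m. (norm (\<Sum>k\<in>A. ?e b k))\<^sup>2) = (\<Sum>b<m. (\<Sum>k\<in>A. ?e b k) * cnj (\<Sum>k\<in>A. ?e b k))"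
    by (simp add: complex_norm_square del: of_real_power)
  also have "\<dots> = (\<Sum>b<m. \<Sum>k\<in>A. \<Sum>k'\<in>A. ?e b k * cnj (?e b k'))"
    by (simp add: sum_product)
  also have "\<dots> = (\<Sum>k\<in>A. \<Sum>b<m. \<Sum>k'\<in>A. ?e b k * cnj (?e b k'))" by (rule sum.swap)
  also have "\<dots> = (\<Sum>k\<in>A. \<Sum>k'\<in>A. \<Sum>b<m. ?e b k * cnj (?e b k'))" by (intro sum.cong refl sum.swap)
  also have "\<dots> = (\<Sum>k\<in>A. \<Sum>k'\<in>A. \<Sum>b<m. cis (2 * pi * real b / real m * of_int (s k - s k')))"
    by (intro sum.cong refl) (simp add: cis_cnj cis_mult right_diff_distrib)
  also have "\<dots> = (\<Sum>k\<in>A. \<Sum>k'\<in>A. if int m dvd (s k - s k') then of_nat m else 0)"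
    unfolding sum_cis_multiples[OF assms(2)] ..
  also have "\<dots> = complex_of_real (\<Sum>k\<in>A. \<Sum>k'\<in>A. real m * (if int m dvd (s k - s k') then 1 else 0))"
    unfolding of_real_sum by (intro sum.cong refl) simp
  finally have "(\<Sum>b<m. (norm (\<Sum>k\<in>A. ?e b k))\<^sup>2)
      = (\<Sum>k\<in>A. \<Sum>k'\<in>A. real m * (if int m dvd (s k - s k') then 1 else 0))"
    by (simp only: of_real_eq_iff)
  then show ?thesis unfolding lhs by (simp only: sum_distrib_left)
qed

text \<open>The frequency \<open>b = 0\<close> contributes exactly \<open>(card A)^2\<close>, and
  subtracting the mean \<open>1 / m\<close> removes it.\<close>

lemma residue_deviation_eq:
  fixes s :: "'b \<Rightarrow> int"
  assumes "finite A" "A \<noteq> {}" "m > 0"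
  shows "(\<Sum>a<m. (real (card {k\<in>A. [s k = int a] (mod int m)}) / card A - 1 / m)\<^sup>2)
    = (\<Sum>b=1..<m. (norm (\<Sum>k\<in>A. cis (2 * pi * real b / real m * of_int (s k))))\<^sup>2) / (m * (real (card A))\<^sup>2)"
proof -
  let ?N = "\<lambda>a. real (card {k\<in>A. [s k = int a] (mod int m)})"
  let ?p = "real (card A)"
  let ?Z = "\<lambda>b. (norm (\<Sum>k\<in>A. cis (2 * pi * real b / real m * of_int (s k))))\<^sup>2"
  have p: "?p > 0" using assms(1,2) by (simp add: card_gt_0_iff)
  have total: "(\<Sum>a<m. ?N a) = ?p"
  proof -
    have "(\<Sum>a<m. ?N a) = (\<Sum>a<m. \<Sum>k\<in>A. if [s k = int a] (mod int m) then 1 else 0)"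
      using assms(1) by (simp add: sum.If_cases Int_def)
    also have "\<dots> = (\<Sum>k\<in>A. \<Sum>a<m. (if [s k = int a] (mod int m) then 1 else 0) * 1)"
      by (subst sum.swap) simp
    also have "\<dots> = ?p" unfolding sum_indicator_residue[OF assms(3)] by simp
    finally show ?thesis .
  qed
  have "{..<m} = insert 0 {1..<m}" using assms(3) by auto
  then have "(\<Sum>b<m. ?Z b) = ?p\<^sup>2 + (\<Sum>b=1..<m. ?Z b)" by simp
  then have sq: "real m * (\<Sum>a<m. (?N a)\<^sup>2) = ?p\<^sup>2 + (\<Sum>b=1..<m. ?Z b)"
    using residue_count_parseval[OF assms(1,3), of s] by simp
  have "(\<Sum>a<m. (?N a / ?p - 1 / m)\<^sup>2) = (\<Sum>a<m. (?N a)\<^sup>2 / ?p\<^sup>2 - 2 / (?p * m) * ?N a + 1 / (real m)\<^sup>2)"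
    by (intro sum.cong refl) (simp add: power2_diff power_divide)
  also have "\<dots> = (\<Sum>a<m. (?N a)\<^sup>2) / ?p\<^sup>2 - 2 / (?p * m) * (\<Sum>a<m. ?N a) + m * (1 / (real m)\<^sup>2)"
    by (simp add: sum.distrib sum_subtractf sum_divide_distrib sum_distrib_left)
  also have "\<dots> = (real m * (\<Sum>a<m. (?N a)\<^sup>2) - ?p\<^sup>2) / (m * ?p\<^sup>2)"
    unfolding total using p assms(3) by (simp add: divide_simps power2_eq_square)
  also have "\<dots> = (\<Sum>b=1..<m. ?Z b) / (m * ?p\<^sup>2)" unfolding sq by simp
  finally show ?thesis .
qed

section \<open>How far the cosines stay from 1 and -1\<close>

lemma sin_ge_inverse_nat:
  assumes "1 \<le> r" "r < m"
  shows "sin (pi * real r / real m) \<ge> 1 / real m"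
proof -
  \<comment> \<open>Reflecting \<open>r\<close> to \<open>m - r\<close> brings the angle
    \<open>t\<close> below \<open>pi / 2\<close>. Up to \<open>pi / 3\<close> the cosine is at least
    1/2, so \<open>sin t >= t / 2 >= 1 / m\<close>; beyond that
    \<open>sin t >= 1 / 2 >= 1 / m\<close>.\<close>
  have small: "sin (pi * real r / real m) \<ge> 1 / real m" if "1 \<le> r" "2 * r \<le> m" for r
  proof -
    define t where "t = pi * real r / real m"
    have "t \<ge> 0" by (simp add: t_def)
    have "real (2 * r) \<le> real m" using that(2) by (simp only: of_nat_le_iff)
    then have "t \<le> pi / 2" using that by (simp add: t_def divide_simps)
    have m2: "real m \<ge> 2" using that by linarith
    show ?thesis
    proof (cases "t \<le> pi / 3")
      case True
      have "(\<lambda>y. sin y - y / 2) 0 \<le> (\<lambda>y. sin y - y / 2) t"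
      proof (rule DERIV_nonneg_imp_nondecreasing[OF \<open>0 \<le> t\<close>])
        fix y assume y: "0 \<le> y" "y \<le> t"
        have "cos (pi / 3) \<le> cos y" using y True by (intro cos_monotone_0_pi_le) auto
        then have "0 \<le> cos y - 1 / 2" by (simp add: cos_60)
        moreover have "((\<lambda>y. sin y - y / 2) has_real_derivative cos y - 1 / 2) (at y)"
          by (auto intro!: derivative_eq_intros)
        ultimately show "\<exists>z. ((\<lambda>y. sin y - y / 2) has_real_derivative z) (at y) \<and> 0 \<le> z" by blast
      qed
      then have "t / 2 \<le> sin t" by simp
      moreover have "1 / real m \<le> t / 2"
      proof -
        have "2 * 1 \<le> pi * real r" using pi_ge_two that(1) by (intro mult_mono) auto
        then show ?thesis using m2 by (simp add: t_def divide_simps)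
      qed
      ultimately show ?thesis by (simp add: t_def)
    next
      case False
      have "sin (pi / 6) \<le> sin t"
        using False \<open>t \<le> pi / 2\<close> pi_gt_zero by (intro sin_monotone_2pi_le) linarith+
      moreover have "1 / real m \<le> 1 / 2" using m2 by (simp add: divide_simps)
      ultimately show ?thesis by (simp add: sin_30 t_def)
    qed
  qed
  show ?thesis
  proof (cases "2 * r \<le> m")
    case True
    then show ?thesis using small assms(1) by simp
  next
    case False
    have "pi * real (m - r) / real m = pi - pi * real r / real m"
      using assms(2) by (simp add: of_nat_diff field_simps)
    then have "sin (pi * real r / real m) = sin (pi * real (m - r) / real m)" by simp
    also have "\<dots> \<ge> 1 / real m" using False assms(2) by (intro small) auto
    finally show ?thesis .
  qed
qed

text \<open>Modulo \<open>pi\<close> the angle is \<open>pi * r / m\<close> with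
  \<open>0 < r < m\<close>, where \<open>r\<close> is \<open>2 * b\<close> or
  \<open>2 * b - m\<close>, so the sine bound applies. It carries over by
  \<open>sin^2 = (1 - |cos|) (1 + |cos|) <= 2 (1 - |cos|)\<close>.\<close>

lemma one_minus_abs_cos_ge:
  assumes "1 \<le> b" "b < m" "2 * b \<noteq> m"
  shows "1 - \<bar>cos (2 * pi * real b / real m)\<bar> \<ge> 1 / (2 * (real m)\<^sup>2)"
proof -
  let ?y = "2 * pi * real b / real m"
  have "1 / real m \<le> \<bar>sin ?y\<bar>"
  proof (cases "2 * b < m")
    case True
    then show ?thesis using sin_ge_inverse_nat[of "2 * b" m] assms(1) by (simp add: mult_ac)
  next
    case False
    have "pi * real (2 * b - m) / real m = ?y - pi"
      using False assms(2) by (simp add: of_nat_diff field_simps)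
    then have "sin (pi * real (2 * b - m) / real m) = - sin ?y" by (simp only:) simp
    moreover have "1 / real m \<le> sin (pi * real (2 * b - m) / real m)"
      using False assms by (intro sin_ge_inverse_nat) auto
    ultimately show ?thesis by linarith
  qed
  then have "(1 / real m)\<^sup>2 \<le> \<bar>sin ?y\<bar>\<^sup>2" by (intro power_mono) auto
  also have "\<dots> = 1 - \<bar>cos ?y\<bar>\<^sup>2" by (simp add: sin_squared_eq)
  also have "\<dots> = (1 - \<bar>cos ?y\<bar>) * (1 + \<bar>cos ?y\<bar>)" by (simp add: power2_eq_square algebra_simps)
  also have "\<dots> \<le> (1 - \<bar>cos ?y\<bar>) * 2"
    by (intro mult_left_mono) simp_all
  finally show ?thesis by (simp add: power_divide)
qed

section \<open>Choice of the block length and the final estimate\<close>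

lemma cong_poly:
  fixes F :: "int poly"
  assumes "[a = b] (mod m)"
  shows "[poly F a = poly F b] (mod m)"
  using assms by (induction F) (simp_all add: cong_add cong_mult)

text \<open>The bounds \<open>t1\<close> to \<open>t4\<close> contribute 64, \<open>14336 d\<close>,
  16384 and \<open>8 (d + 1)^2\<close>, with \<open>64 + 16384 = 16448\<close>. The term
  \<open>256 d^2\<close> dominates \<open>log p\<close> for primes up to
  \<open>16 d^2\<close>.\<close>

lemma residue_proportion_deviation:
  assumes p: "prime p" "2 < p" and sqf: "poly_mod.square_free_m (int p) F"
    and d: "poly_mod.degree_m (int p) F = d" "1 \<le> d" and m: "2 \<le> m"
  shows "(\<Sum>a<m. (residue_proportion p F m (int a) - 1 / real m)\<^sup>2)
    \<le> (16448 + 14336 * real d + 8 * (real d + 1)\<^sup>2 + 256 * (real d)\<^sup>2) * (real m)\<^sup>2 / ln (real p)"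
    (is "?D \<le> ?C * _ / _")
proof -
  define L where "L = ln (real p)"
  define Z where "Z = (\<lambda>b. \<Sum>k=1..p. cis (2 * pi * real b / real m * of_int (legendre_sum p F k)))"
  have L1: "L \<ge> 1"
  proof -
    have "exp 1 \<le> real p" using exp_le p(2) by linarith
    then show ?thesis using p(2) by (simp add: L_def ln_ge_iff)
  qed
  have p0: "real p > 0" using p(2) by simp
  have D: "?D = (\<Sum>b=1..<m. (norm (Z b))\<^sup>2) / (m * (real p)\<^sup>2)"
    using residue_deviation_eq[of "{1..p}" m "legendre_sum p F"] p(2) m
    by (simp add: residue_proportion_def Z_def)
  have D_le: "?D \<le> B / (real p)\<^sup>2" if "\<And>b. b \<in> {1..<m} \<Longrightarrow> (norm (Z b))\<^sup>2 \<le> B" "B \<ge> 0" for B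
  proof -
    have "(\<Sum>b=1..<m. (norm (Z b))\<^sup>2) \<le> (\<Sum>b=1..<m. B)" using that(1) by (intro sum_mono)
    also have "\<dots> \<le> m * B" using that(2) by (simp add: mult_right_mono)
    finally have "?D \<le> m * B / (m * (real p)\<^sup>2)" unfolding D by (intro divide_right_mono) auto
    then show ?thesis using m by simp
  qed
  have m2: "(real m)\<^sup>2 \<ge> 1" using m by simp
  have C0: "?C \<ge> 0" by simp
  have "?D * L \<le> ?C * (real m)\<^sup>2"
  proof (cases "2 * real d * L < p")
    \<comment> \<open>Here \<open>p\<close> is too small relative to \<open>d\<close> to secure
      \<open>H * d < p\<close>. Then \<open>p <= 16 * d^2\<close>, and the trivial bound 1 for the
      deviation is enough.\<close>
    case False
    have "L \<le> 2 * sqrt p"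
      using ln_powr_bound[of "real p" "1/2"] p(2) by (simp add: L_def powr_half_sqrt)
    then have "2 * real d * L \<le> 2 * real d * (2 * sqrt p)" by (intro mult_left_mono) auto
    then have "real p \<le> 2 * real d * (2 * sqrt p)" using False by linarith
    then have "sqrt p * sqrt p \<le> (4 * real d) * sqrt p" by simp
    then have "sqrt p \<le> 4 * real d" using p0 by (simp only: mult_le_cancel_right_pos real_sqrt_gt_zero)
    then have "(sqrt p)\<^sup>2 \<le> (4 * real d)\<^sup>2" by (intro power_mono) auto
    then have "real p \<le> 16 * (real d)\<^sup>2" by (simp add: power_mult_distrib)
    moreover have "L \<le> real p" using ln_le_minus_one[OF p0] by (simp add: L_def)
    ultimately have "L \<le> ?C" using zero_le_power2[of "real d"] zero_le_power2[of "real d + 1"] by linarith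
    moreover have "?D \<le> 1"
    proof -
      have "norm (Z b) \<le> p" for b
        unfolding Z_def by (rule order.trans[OF norm_sum]) simp
      then have "(norm (Z b))\<^sup>2 \<le> (real p)\<^sup>2" for b by (intro power_mono) auto
      then show ?thesis using D_le[of "(real p)\<^sup>2"] p0 by simp
    qed
    ultimately have "?D * L \<le> 1 * ?C" using L1 by (intro mult_mono) auto
    also have "\<dots> \<le> ?C * (real m)\<^sup>2" using C0 m2 mult_left_mono[of 1 "(real m)\<^sup>2" ?C] by simp
    finally show ?thesis .
  next
    case True
    \<comment> \<open>The divisor 8 gives \<open>2 ^ H <= 2 * p powr (1/8)\<close>, so that
      \<open>2 ^ H * sqrt p\<close> is below \<open>p\<close> by a power of
      \<open>p\<close>.\<close>
    define H where "H = nat \<lceil>L / 8\<rceil>"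
    have H: "real H \<ge> L / 8" "real H \<le> L / 8 + 1" "H > 0" using L1 by (auto simp: H_def)
    have H2: "real H \<le> 2 * L" using H(2) L1 by linarith
    have "real (H * d) \<le> 2 * L * real d" using H2 by (simp add: mult_right_mono)
    also have "\<dots> < real p" using True by (simp add: mult_ac)
    finally have Hd: "H * d < p" by (simp only: of_nat_less_iff)
    define E where "E = 27 * real d * H * sqrt p"
    interpret ps: pseudorandom_signs "\<lambda>n. Legendre (poly F (int n)) (int p)" p H d E
    proof
      have weil: "shifted_weil p" using p by (rule shifted_weil_prime)
      show "Legendre (poly F (int n)) (int p) = -1 \<or> Legendre (poly F (int n)) (int p) = 0
          \<or> Legendre (poly F (int n)) (int p) = 1" for n by (rule Legendre_values)
      show "Legendre (poly F (int (n + p))) (int p) = Legendre (poly F (int n)) (int p)" for n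
      proof -
        have "[poly F (int (n + p)) = poly F (int n)] (mod int p)"
          by (intro cong_poly) (simp add: cong_def)
        then show ?thesis by (simp add: Legendre_def QuadRes_def cong_def)
      qed
      show "card {k\<in>{..<p}. Legendre (poly F (int k)) (int p) = 0} \<le> d"
        using weil sqf d unfolding shifted_weil_def by blast
      show "\<bar>real_of_int (\<Sum>k<p. \<Prod>j\<in>J. Legendre (poly F (int (k + j))) (int p))\<bar> \<le> E"
        if "J \<subseteq> {..<H}" "J \<noteq> {}" for J
      proof -
        have "\<bar>real_of_int (\<Sum>k<p. \<Prod>j\<in>J. Legendre (poly F (int (k + j))) (int p))\<bar> \<le> 27 * d * card J * sqrt p"
          using weil sqf d that Hd unfolding shifted_weil_def by blast
        moreover have "real (card J) \<le> real H" using card_mono[OF _ that(1)] by simp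
        then have "27 * real d * real (card J) * sqrt p \<le> E"
          unfolding E_def by (intro mult_right_mono mult_left_mono) auto
        ultimately show ?thesis by simp
      qed
      show "0 < H" by fact
      show "0 < p" using p(2) by simp
      show "0 \<le> E" by (simp add: E_def)
    qed
    have Z_phase: "Z b = (\<Sum>k<p. ps.phase (2 * pi * real b / real m) k)" for b
    proof -
      have "Z b = (\<Sum>k<p. cis (2 * pi * real b / real m * of_int (legendre_sum p F (Suc k))))"
        using sum.atLeast1_atMost_eq[of "\<lambda>k. cis (2 * pi * real b / real m * of_int (legendre_sum p F k))" p]
        by (simp add: Z_def)
      then show ?thesis by (simp only: ps.phase_def ps.walk_def legendre_sum_def)
    qed
    define E' where "E' = 2 * H * d + 2 ^ H * E"
    have "E' \<ge> 0" by (simp add: E'_def E_def)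
    \<comment> \<open>One bound for all frequencies: the last summand serves
      \<open>2 * b = m\<close>, the others come from the averaging bound with
      \<open>1 / (1 - q) <= 2 * m^2\<close>.\<close>
    define B where "B = (real p)\<^sup>2 * (8 * (real m)\<^sup>2 / H) + 2 * p * E' + 8 * (real H)\<^sup>2 + (real d + 1)\<^sup>2"
    have "(norm (Z b))\<^sup>2 \<le> B" if b: "b \<in> {1..<m}" for b
    proof (cases "2 * b = m")
      case True
      then have "2 * pi * real b / real m = pi" using m by (auto simp: field_simps)
      then have "norm (Z b) \<le> d + 1"
        unfolding Z_phase by (intro ps.phase_sum_bound_alternating) simp
      then have "(norm (Z b))\<^sup>2 \<le> (real d + 1)\<^sup>2" by (intro power_mono) auto
      also have "\<dots> \<le> B" using \<open>E' \<ge> 0\<close> by (simp add: B_def)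
      finally show ?thesis .
    next
      case False
      define q where "q = \<bar>cos (2 * pi * real b / real m)\<bar>"
      have q: "1 - q \<ge> 1 / (2 * (real m)\<^sup>2)"
        unfolding q_def using b False by (intro one_minus_abs_cos_ge) auto
      have "1 / (2 * (real m)\<^sup>2) > 0" using m by simp
      then have "q < 1" using q by linarith
      have "(norm (Z b))\<^sup>2 \<le> (real p)\<^sup>2 * (4 / (H * (1 - q))) + 2 * p * E' + 8 * (real H)\<^sup>2"
        unfolding Z_phase E'_def q_def using \<open>q < 1\<close> by (intro ps.phase_sum_bound) (simp add: q_def)
      moreover have "4 / (H * (1 - q)) \<le> 8 * (real m)\<^sup>2 / H"
      proof -
        have "1 \<le> (1 - q) * (2 * (real m)\<^sup>2)" using q m by (simp add: divide_simps)
        then have "1 / (1 - q) \<le> 2 * (real m)\<^sup>2" using \<open>q < 1\<close> by (simp add: divide_le_eq mult.commute)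
        then have "4 / H * (1 / (1 - q)) \<le> 4 / H * (2 * (real m)\<^sup>2)" by (intro mult_left_mono) auto
        then show ?thesis by simp
      qed
      then have "(real p)\<^sup>2 * (4 / (H * (1 - q))) \<le> (real p)\<^sup>2 * (8 * (real m)\<^sup>2 / H)"
        by (intro mult_left_mono) auto
      moreover have "0 \<le> (real d + 1)\<^sup>2" by simp
      ultimately show ?thesis unfolding B_def by linarith
    qed
    then have "?D \<le> B / (real p)\<^sup>2" using \<open>E' \<ge> 0\<close> by (intro D_le) (auto simp: B_def)
    also have "\<dots> = 8 * (real m)\<^sup>2 / H + 2 * E' / p + 8 * (real H)\<^sup>2 / (real p)\<^sup>2 + (real d + 1)\<^sup>2 / (real p)\<^sup>2"
      unfolding B_def add_divide_distrib using p0 by (simp add: power2_eq_square)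
    finally have DB: "?D \<le> \<dots>" .
    \<comment> \<open>All quantities are compared with powers of \<open>s\<close>:
      \<open>2 ^ H\<close>, \<open>H\<close> and \<open>L\<close> are at most multiples of
      \<open>s\<close>, and \<open>sqrt p = s ^ 4\<close>. Hence \<open>E' * L\<close> is at most a
      multiple of \<open>d * s ^ 7\<close>, against \<open>p = s ^ 8\<close>.\<close>
    define s where "s = real p powr (1 / 8)"
    have s1: "s \<ge> 1" unfolding s_def using p(2) by (intro ge_one_powr_ge_zero) auto
    have s8: "real p = s ^ 8"
      using p0 by (simp add: s_def powr_realpow[symmetric] powr_powr)
    have "sqrt p = s ^ 4"
      unfolding s8 using s1 by (intro real_sqrt_unique) (simp_all add: power_mult[symmetric])
    have Ls: "L \<le> 8 * s"
      using ln_powr_bound[of "real p" "1/8"] p(2) by (simp add: L_def s_def)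
    have "2 powr (L / 8) \<le> exp (L / 8)"
    proof -
      have "L / 8 * ln 2 \<le> L / 8 * 1" using ln_le_minus_one[of 2] L1 by (intro mult_left_mono) auto
      then show ?thesis by (simp add: powr_def)
    qed
    also have "\<dots> = s" using p0 by (simp add: s_def powr_def L_def)
    finally have "2 powr (L / 8) \<le> s" .
    then have "2 powr (L / 8 + 1) \<le> 2 * s" by (simp add: powr_add)
    moreover have "2 ^ H \<le> 2 powr (L / 8 + 1)"
      using H(2) powr_mono[of "real H" "L / 8 + 1" 2] by (simp add: powr_realpow)
    ultimately have pow2: "2 ^ H \<le> 2 * s" by linarith
    have Hs: "real H \<le> 16 * s" using H2 Ls by linarith
    have E's: "E' \<le> 896 * d * s ^ 6"
    proof -
      have "2 * real H * d \<le> 32 * d * s" using Hs mult_right_mono[of "real H" "16 * s" "real d"] by simp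
      also have "\<dots> \<le> 32 * d * s ^ 6"
        using s1 power_increasing[of 1 6 s] by (intro mult_left_mono) auto
      finally have 1: "2 * real H * d \<le> 32 * d * s ^ 6" .
      have "E \<le> 27 * real d * (16 * s) * s ^ 4"
        unfolding E_def \<open>sqrt p = s ^ 4\<close> using Hs s1 by (intro mult_right_mono mult_left_mono) auto
      then have "2 ^ H * E \<le> (2 * s) * (27 * real d * (16 * s) * s ^ 4)"
        using pow2 s1 by (intro mult_mono) (auto simp: E_def)
      also have "\<dots> = 864 * d * s ^ 6" by (simp add: power_def numeral_eq_Suc)
      finally show ?thesis using 1 by (simp add: E'_def)
    qed
    have t1: "8 * (real m)\<^sup>2 / H * L \<le> 64 * (real m)\<^sup>2"
    proof -
      have "L / H \<le> 8" using H by (simp add: divide_simps)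
      then have "8 * (real m)\<^sup>2 * (L / H) \<le> 8 * (real m)\<^sup>2 * 8" by (intro mult_left_mono) auto
      then show ?thesis by simp
    qed
    have t2: "2 * E' / p * L \<le> 14336 * d"
    proof -
      have "E' * L \<le> (896 * d * s ^ 6) * (8 * s)"
        using E's Ls s1 L1 \<open>E' \<ge> 0\<close> by (intro mult_mono) auto
      also have "\<dots> = 7168 * d * s ^ 7" by (simp add: numeral_eq_Suc)
      also have "\<dots> \<le> 7168 * d * s ^ 8"
        using s1 power_increasing[of 7 8 s] by (intro mult_left_mono) auto
      finally have "2 * (E' * L) \<le> 14336 * real d * real p" unfolding s8 by simp
      then show ?thesis using p0 by (simp add: divide_le_eq)
    qed
    have pp: "(real p)\<^sup>2 = s ^ 16" unfolding s8 by (simp add: power_mult[symmetric])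
    have t3: "8 * (real H)\<^sup>2 / (real p)\<^sup>2 * L \<le> 16384"
    proof -
      have "(real H)\<^sup>2 * L \<le> (16 * s)\<^sup>2 * (8 * s)"
        using Hs Ls s1 L1 by (intro mult_mono power_mono) auto
      also have "\<dots> = 2048 * s ^ 3" by (simp add: numeral_eq_Suc)
      also have "\<dots> \<le> 2048 * s ^ 16"
        using s1 power_increasing[of 3 16 s] by (intro mult_left_mono) auto
      finally have "8 * ((real H)\<^sup>2 * L) \<le> 16384 * s ^ 16" by linarith
      moreover have "s ^ 16 > 0" using s1 by simp
      ultimately have "8 * ((real H)\<^sup>2 * L) / s ^ 16 \<le> 16384" by (simp only: pos_divide_le_eq)
      then show ?thesis unfolding pp by simp
    qed
    have t4: "(real d + 1)\<^sup>2 / (real p)\<^sup>2 * L \<le> 8 * (real d + 1)\<^sup>2"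
    proof -
      have "L \<le> 8 * s ^ 16" using Ls s1 power_increasing[of 1 16 s] by simp
      then have "(real d + 1)\<^sup>2 * L \<le> (real d + 1)\<^sup>2 * (8 * s ^ 16)" by (intro mult_left_mono) auto
      then show ?thesis unfolding pp using s1 by (simp add: divide_le_eq mult_ac)
    qed
    define K where "K = 14336 * real d + 16384 + 8 * (real d + 1)\<^sup>2"
    have "?D * L \<le> 64 * (real m)\<^sup>2 + K"
      using mult_right_mono[OF DB, of L] L1 t1 t2 t3 t4 unfolding distrib_right K_def by linarith
    also have "\<dots> \<le> 64 * (real m)\<^sup>2 + K * (real m)\<^sup>2"
      using mult_left_mono[OF m2, of K] by (simp add: K_def)
    also have "\<dots> = (64 + K) * (real m)\<^sup>2" by (simp add: distrib_right)
    also have "\<dots> \<le> ?C * (real m)\<^sup>2" by (intro mult_right_mono) (simp_all add: K_def)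
    finally show ?thesis .
  qed
  then show ?thesis using L1 by (simp add: L_def[symmetric] pos_le_divide_eq)
qed

theorem theorem1:
  shows "\<exists>p0::nat. \<forall>d::nat. \<forall>c::real. 1 \<le> d \<longrightarrow> c > 0 \<longrightarrow>
    (\<exists>C::real. C > 0 \<and>
      (\<forall>(p::nat) (F::int poly) (m::nat).
         prime p \<longrightarrow> p \<ge> p0 \<longrightarrow>
         poly_mod.square_free_m (int p) F \<longrightarrow> poly_mod.degree_m (int p) F = d \<longrightarrow>
         2 \<le> m \<longrightarrow> real m \<le> c * ln (real p) powr (1 / 4) \<longrightarrow>
         (\<Sum>a = 0..m - 1. (residue_proportion p F m (int a) - 1 / real m)\<^sup>2)
           \<le> C * (real m)\<^sup>2 / ln (real p)))"
proof (rule exI[of _ 3], intro allI impI, goal_cases)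
  case (1 d c)
  \<comment> \<open>A threshold of 3 serves every \<open>d\<close>, because primes that are small
    relative to \<open>d\<close> are absorbed into the constant.\<close>
  let ?C = "16448 + 14336 * real d + 8 * (real d + 1)\<^sup>2 + 256 * (real d)\<^sup>2"
  have "?C > 0" by (simp add: add_pos_nonneg)
  moreover have "(\<Sum>a = 0..m - 1. (residue_proportion p F m (int a) - 1 / real m)\<^sup>2)
      \<le> ?C * (real m)\<^sup>2 / ln (real p)"
    if "prime p" "p \<ge> 3" "poly_mod.square_free_m (int p) F" "poly_mod.degree_m (int p) F = d" "2 \<le> m"
    for p F m
  proof -
    have "{0..m - 1} = {..<m}" using that(5) by auto
    then show ?thesis using residue_proportion_deviation[of p F d m] that 1(1) by simp
  qed
  ultimately show ?case by blast
qed

end
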